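(* Let $n\geq 4$ and let $W_n$ be a rank-$n$ irreducible CFC-finite Coxeter group of a fixed type. Let $W_{n-1}$ be the parabolic subgroup of $W_n$ generated by all generators except the rightmost generator of the branch of $W_n$, and let $W_{n-2}$ be obtained from $W_{n-1}$ in the same way (by deleting the next rightmost generator of the branch). If $\alpha_i=|\mathrm{CFC}(W_i)|$, then $$\alpha_n=3\alpha_{n-1}-\alpha_{n-2}.$$
   Context: $(W,S)$ denotes a Coxeter system of finite rank: $W=\langle S\mid (st)^{m(s,t)}=1\rangle$, where $m(s,t)=m(t,s)\in\{1,2,\dots,\infty\}$ and $m(s,t)=1$ iff $s=t$. The Coxeter graph has vertex set $S$ and an edge $\{s,t\}$ labeled $m(s,t)$ whenever $m(s,t)\ge 3$ (label $3$ omitted); $W$ is irreducible if this graph is connected. An expression for $w$ is a word in $S$ representing $w$; it is reduced if it has minimal length. Two words are commutation equivalent if they differ by a sequence of moves $st\leftrightarrow ts$ with $m(s,t)=2$. An element is fully commutative (FC) if all its reduced expressions are commutation equivalent. A cyclic shift of a word is any word obtained by repeatedly moving the first letter to the end. $w\in\mathrm{CFC}(W)$ (cyclically fully commutative) if every cyclic shift of every reduced expression for $w$ is a reduced expression for an FC element. $W$ is CFC-finite if $\mathrm{CFC}(W)$ is finite. The irreducible CFC-finite Coxeter groups of rank $n\ge 4$ are the following; the branch is the type $A$ subgraph consisting of the indicated branch vertex $s_0$ and everything to its right, where paths are written left to right (all labels are $3$ unless stated otherwise): $A_n$ ($n\ge4$): path $v_1,\dots,v_n$, $s_0=v_1$.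 $B_n$ ($n\ge4$): path $v_1,\dots,v_n$ with edge $\{v_1,v_2\}$ labeled $4$, $s_0=v_2$. $D_n$ ($n\ge4$): path $v_1,\dots,v_{n-1}$ with one extra vertex joined to $v_2$, $s_0=v_2$. $E_n$ ($n\ge6$): path $v_1,\dots,v_{n-1}$ with one extra vertex joined to $v_3$, $s_0=v_3$. $F_n$ ($n\ge4$): path $v_1,\dots,v_n$ with edge $\{v_2,v_3\}$ labeled $4$, $s_0=v_3$. $H_n$ ($n\ge4$): path $v_1,\dots,v_n$ with edge $\{v_1,v_2\}$ labeled $5$, $s_0=v_2$. Thus the rightmost generator of the branch is the last vertex of the path, and $W_{n-1}$, $W_{n-2}$ are the parabolic subgroups obtained by deleting the last vertex, respectively the last two vertices, of the path. *)

theory Defs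
  imports "HOL-Algebra.Generated_Groups" "HOL-Library.Extended_Nat"
begin

section \<open>Coxeter systems\<close>

definition coxeter_matrix :: "'a set \<Rightarrow> ('a \<Rightarrow> 'a \<Rightarrow> enat) \<Rightarrow> bool" where
  "coxeter_matrix S m \<longleftrightarrow>
     (\<forall>s\<in>S. \<forall>t\<in>S. m s t = m t s \<and> 1 \<le> m s t \<and> (m s t = 1 \<longleftrightarrow> s = t))"

text \<open>
  The congruence on words over \<open>S\<close> generated by the relations \<open>(st)\<^sup>k = 1\<close> with \<open>m(s,t) = k < \<infinity>\<close>.
  Since \<open>m(s,s) = 1\<close> gives \<open>ss = 1\<close>, every generator is its own inverse, so the monoid with this
  presentation is the group with this presentation and no formal inverses are needed.
\<close>

inductive coxeter_cong :: "'a set \<Rightarrow> ('a \<Rightarrow> 'a \<Rightarrow> enat) \<Rightarrow> 'a list \<Rightarrow> 'a list \<Rightarrow> bool"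
  for S m where
  refl: "u \<in> lists S \<Longrightarrow> coxeter_cong S m u u"
| sym: "coxeter_cong S m u v \<Longrightarrow> coxeter_cong S m v u"
| trans: "coxeter_cong S m u v \<Longrightarrow> coxeter_cong S m v w \<Longrightarrow> coxeter_cong S m u w"
| relation: "s \<in> S \<Longrightarrow> t \<in> S \<Longrightarrow> m s t = enat k \<Longrightarrow> u \<in> lists S \<Longrightarrow> v \<in> lists S \<Longrightarrow>
     coxeter_cong S m (u @ concat (replicate k [s, t]) @ v) (u @ v)"

definition eval_word :: "('a, 'b) monoid_scheme \<Rightarrow> 'a list \<Rightarrow> 'a" where
  "eval_word W u = foldr (\<lambda>x y. x \<otimes>\<^bsub>W\<^esub> y) u \<one>\<^bsub>W\<^esub>"

definition coxeter_system ::
  "('a, 'b) monoid_scheme \<Rightarrow> 'a set \<Rightarrow> ('a \<Rightarrow> 'a \<Rightarrow> enat) \<Rightarrow> bool" where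
  "coxeter_system W S m \<longleftrightarrow>
     group W \<and> S \<subseteq> carrier W \<and> finite S \<and> coxeter_matrix S m \<and>
     generate W S = carrier W \<and>
     (\<forall>u\<in>lists S. \<forall>v\<in>lists S. eval_word W u = eval_word W v \<longleftrightarrow> coxeter_cong S m u v)"

definition coxeter_edge :: "'a set \<Rightarrow> ('a \<Rightarrow> 'a \<Rightarrow> enat) \<Rightarrow> 'a \<Rightarrow> 'a \<Rightarrow> bool" where
  "coxeter_edge S m s t \<longleftrightarrow> s \<in> S \<and> t \<in> S \<and> 3 \<le> m s t"

definition coxeter_irreducible :: "'a set \<Rightarrow> ('a \<Rightarrow> 'a \<Rightarrow> enat) \<Rightarrow> bool" where
  "coxeter_irreducible S m \<longleftrightarrow> (\<forall>s\<in>S. \<forall>t\<in>S. (coxeter_edge S m)\<^sup>*\<^sup>* s t)"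

section \<open>Cyclically fully commutative elements\<close>

text \<open>
  The definitions below are applied both to \<open>(W, S)\<close> and to the parabolic subgroups \<open>(W\<^sub>J, J)\<close>,
  \<open>J \<subseteq> S\<close>, where \<open>W\<^sub>J\<close> is \<open>subgroup_generated W J\<close>. Only the values of \<open>m\<close> on the given
  generating set matter.
\<close>

definition expression_for :: "('a, 'b) monoid_scheme \<Rightarrow> 'a set \<Rightarrow> 'a list \<Rightarrow> 'a \<Rightarrow> bool" where
  "expression_for W S u w \<longleftrightarrow> u \<in> lists S \<and> eval_word W u = w"

definition reduced_expression_for ::
  "('a, 'b) monoid_scheme \<Rightarrow> 'a set \<Rightarrow> 'a list \<Rightarrow> 'a \<Rightarrow> bool" where
  "reduced_expression_for W S u w \<longleftrightarrow>
     expression_for W S u w \<and> (\<forall>v. expression_for W S v w \<longrightarrow> length u \<le> length v)"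

inductive commutation_move :: "('a \<Rightarrow> 'a \<Rightarrow> enat) \<Rightarrow> 'a list \<Rightarrow> 'a list \<Rightarrow> bool"
  for m where
  "m s t = 2 \<Longrightarrow> commutation_move m (u @ [s, t] @ v) (u @ [t, s] @ v)"

definition commutation_equivalent :: "('a \<Rightarrow> 'a \<Rightarrow> enat) \<Rightarrow> 'a list \<Rightarrow> 'a list \<Rightarrow> bool" where
  "commutation_equivalent m = equivclp (commutation_move m)"

definition FC :: "('a, 'b) monoid_scheme \<Rightarrow> 'a set \<Rightarrow> ('a \<Rightarrow> 'a \<Rightarrow> enat) \<Rightarrow> 'a set" where
  "FC W S m = {w \<in> carrier W. \<forall>u v.
     reduced_expression_for W S u w \<longrightarrow> reduced_expression_for W S v w \<longrightarrow>
     commutation_equivalent m u v}"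

definition CFC :: "('a, 'b) monoid_scheme \<Rightarrow> 'a set \<Rightarrow> ('a \<Rightarrow> 'a \<Rightarrow> enat) \<Rightarrow> 'a set" where
  "CFC W S m = {w \<in> carrier W. \<forall>u. reduced_expression_for W S u w \<longrightarrow>
     (\<forall>k. \<exists>x \<in> FC W S m. reduced_expression_for W S (rotate k u) x)}"

definition CFC_finite :: "('a, 'b) monoid_scheme \<Rightarrow> 'a set \<Rightarrow> ('a \<Rightarrow> 'a \<Rightarrow> enat) \<Rightarrow> bool" where
  "CFC_finite W S m \<longleftrightarrow> finite (CFC W S m)"

section \<open>The types of irreducible CFC-finite Coxeter groups of rank at least 4\<close>

datatype cfc_type = Type_A | Type_B | Type_D | Type_E | Type_F | Type_H

text \<open>
  The path \<open>v\<^sub>1, v\<^sub>2, \<dots>\<close> is numbered \<open>1, 2, \<dots>\<close>; the extra vertex in types \<open>D\<close> and \<open>E\<close> is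
  numbered \<open>0\<close>. With this numbering the labels do not depend on the rank, and
  \<open>path_length T n\<close> is the number of the last vertex of the path.
\<close>

fun path_length :: "cfc_type \<Rightarrow> nat \<Rightarrow> nat" where
  "path_length Type_D n = n - 1"
| "path_length Type_E n = n - 1"
| "path_length _ n = n"

fun extra_vertices :: "cfc_type \<Rightarrow> nat set" where
  "extra_vertices Type_D = {0}"
| "extra_vertices Type_E = {0}"
| "extra_vertices _ = {}"

definition vertices :: "cfc_type \<Rightarrow> nat \<Rightarrow> nat set" where
  "vertices T n = {1..path_length T n} \<union> extra_vertices T"

text \<open>\<open>path_label T i\<close> is the label of the edge \<open>{v\<^sub>i, v\<^sub>i\<^sub>+\<^sub>1}\<close>.\<close>

definition path_label :: "cfc_type \<Rightarrow> nat \<Rightarrow> enat" where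
  "path_label T i =
     (if T = Type_B \<and> i = 1 then 4
      else if T = Type_F \<and> i = 2 then 4
      else if T = Type_H \<and> i = 1 then 5
      else 3)"

fun branch_vertex :: "cfc_type \<Rightarrow> nat" where
  "branch_vertex Type_A = 1"
| "branch_vertex Type_B = 2"
| "branch_vertex Type_D = 2"
| "branch_vertex Type_E = 3"
| "branch_vertex Type_F = 3"
| "branch_vertex Type_H = 2"

definition branch :: "cfc_type \<Rightarrow> nat \<Rightarrow> nat set" where
  "branch T n = {branch_vertex T..path_length T n}"

text \<open>
  Deleting vertex \<open>rightmost T n\<close> from the graph of type \<open>T\<close> and rank \<open>n\<close> leaves the graph of type
  \<open>T\<close> and rank \<open>n - 1\<close>, with the same numbering and labels; so \<open>rightmost T (n - 1)\<close> is the next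
  rightmost vertex of the branch.
\<close>

definition rightmost :: "cfc_type \<Rightarrow> nat \<Rightarrow> nat" where
  "rightmost T n = Max (branch T n)"

text \<open>The extra vertex \<open>0\<close> of types \<open>D\<close> and \<open>E\<close> is joined exactly to the branch vertex.\<close>

definition type_matrix :: "cfc_type \<Rightarrow> nat \<Rightarrow> nat \<Rightarrow> enat" where
  "type_matrix T i j =
     (let a = min i j; b = max i j in
      if a = b then 1
      else if a = 0 then (if b = branch_vertex T then 3 else 2)
      else if b = Suc a then path_label T a
      else 2)"

definition coxeter_labelling ::
  "cfc_type \<Rightarrow> nat \<Rightarrow> (nat \<Rightarrow> 'a) \<Rightarrow> 'a set \<Rightarrow> ('a \<Rightarrow> 'a \<Rightarrow> enat) \<Rightarrow> bool" where
  "coxeter_labelling T n \<nu> S m \<longleftrightarrow>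
     bij_betw \<nu> (vertices T n) S \<and>
     (\<forall>i\<in>vertices T n. \<forall>j\<in>vertices T n. m (\<nu> i) (\<nu> j) = type_matrix T i j)"

end

theory Submission
  imports Defs
begin

text \<open>
  Let \<open>s\<close>, \<open>t\<close> be the last two vertices of the path and \<open>J\<close>, \<open>K\<close> the generating sets without \<open>t\<close>,
  respectively without \<open>s\<close> and \<open>t\<close>. The point is that \<open>s\<close> and \<open>t\<close> occur at most once in every
  reduced word of a CFC element. Read such a word cyclically. Between two occurrences of a vertex
  all of whose edges have label 3 there are at least two occurrences of neighbours. If \<open>s\<close> or \<open>t\<close>
  occurred twice, some two cyclically consecutive \<open>s\<close> would have no \<open>t\<close> between them, hence two
  occurrences of the neighbour to the left with no \<open>s\<close> between them, and so on down to the branch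
  vertex, where the few remaining vertices do not suffice to avoid a long braid.

  Since \<open>t\<close> commutes with everything but \<open>s\<close>, a CFC element involving \<open>t\<close> is therefore \<open>tw\<close> or \<open>wt\<close> with
  \<open>w \<in> CFC(W\<^sub>J)\<close>; conversely all these products are CFC, and \<open>tw = w't\<close> forces \<open>w = w' \<in> W\<^sub>K\<close>. So
  \<open>CFC(W)\<close> is the disjoint union of \<open>CFC(W\<^sub>J)\<close> and \<open>t CFC(W\<^sub>J) \<union> CFC(W\<^sub>J) t\<close>, and the last two sets
  meet in \<open>t CFC(W\<^sub>K)\<close>.

  The only Coxeter group theory this needs is the exchange condition, which follows from the fact
  that the parity of the number of times a reflection occurs among the reflections
  \<open>s\<^sub>1\<dots>s\<^sub>i\<dots>s\<^sub>1\<close> of a word \<open>s\<^sub>1\<dots>s\<^sub>k\<close> does not change under the defining relations.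
\<close>

section \<open>Words in a Coxeter group\<close>

locale coxeter_group = group W for W (structure) +
  fixes S :: "'a set" and m :: "'a \<Rightarrow> 'a \<Rightarrow> enat"
  assumes coxeter_system: "coxeter_system W S m"
begin

abbreviation ev :: "'a list \<Rightarrow> 'a" where
  "ev \<equiv> eval_word W"

definition reduced :: "'a list \<Rightarrow> bool" where
  "reduced u \<longleftrightarrow> u \<in> lists S \<and> (\<forall>v\<in>lists S. ev v = ev u \<longrightarrow> length u \<le> length v)"

lemma reduced_expression_for_iff: "reduced_expression_for W S u w \<longleftrightarrow> reduced u \<and> ev u = w"
  by (auto simp: reduced_expression_for_def expression_for_def reduced_def)

lemma generators_closed: "S \<subseteq> carrier W"
  and matrix: "coxeter_matrix S m"
  and generate_S: "generate W S = carrier W"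
  and ev_eq_iff: "\<lbrakk>u \<in> lists S; v \<in> lists S\<rbrakk> \<Longrightarrow> ev u = ev v \<longleftrightarrow> coxeter_cong S m u v"
  using coxeter_system by (auto simp: coxeter_system_def)

lemma generator_closed [simp]: "s \<in> S \<Longrightarrow> s \<in> carrier W"
  using generators_closed by blast

lemma m_sym: "\<lbrakk>s \<in> S; t \<in> S\<rbrakk> \<Longrightarrow> m s t = m t s"
  and m_self: "s \<in> S \<Longrightarrow> m s s = 1"
  using matrix by (auto simp: coxeter_matrix_def)

lemma ev_Nil [simp]: "ev [] = \<one>"
  and ev_Cons [simp]: "ev (s # u) = s \<otimes> ev u"
  by (simp_all add: eval_word_def)

lemma ev_closed [simp]: "u \<in> lists S \<Longrightarrow> ev u \<in> carrier W"
  by (induction u) auto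

lemma ev_append [simp]: "\<lbrakk>u \<in> lists S; v \<in> lists S\<rbrakk> \<Longrightarrow> ev (u @ v) = ev u \<otimes> ev v"
  by (induction u) (auto simp: m_assoc)

lemma alternating_lists: "\<lbrakk>s \<in> S; t \<in> S\<rbrakk> \<Longrightarrow> concat (replicate k [s, t]) \<in> lists S"
  by (induction k) auto

lemma relation_word:
  assumes "s \<in> S" "t \<in> S" "m s t = enat k"
  shows "ev (concat (replicate k [s, t])) = \<one>"
proof -
  have "concat (replicate k [s, t]) \<in> lists S"
    using assms by (simp only: alternating_lists)
  moreover have "coxeter_cong S m ([] @ concat (replicate k [s, t]) @ []) ([] @ [])"
    using assms by (intro coxeter_cong.relation) auto
  ultimately show ?thesis
    using ev_eq_iff[of "concat (replicate k [s, t])" "[]"] by simp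
qed

lemma generator_square [simp]: "s \<in> S \<Longrightarrow> s \<otimes> s = \<one>"
  using relation_word[of s s 1] m_self by (simp add: one_enat_def)

lemma generator_cancel [simp]: "\<lbrakk>s \<in> S; g \<in> carrier W\<rbrakk> \<Longrightarrow> s \<otimes> (s \<otimes> g) = g"
  by (simp flip: m_assoc)

lemma inv_generator [simp]: "s \<in> S \<Longrightarrow> inv s = s"
  by (simp add: inv_equality)

lemma ev_rev: "u \<in> lists S \<Longrightarrow> ev (rev u) = inv (ev u)"
proof (induction u)
  case (Cons a u)
  then have "rev u \<in> lists S" by auto
  then show ?case using Cons by (simp add: inv_mult_group)
qed simp

lemma generate_eq_ev:
  assumes "J \<subseteq> S"
  shows "generate W J = ev ` lists J"
proof
  have "g \<in> ev ` lists J" if "g \<in> generate W J" for g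
    using that
  proof induction
    case one
    show ?case by (rule image_eqI[of _ _ "[]"]) auto
  next
    case (incl h)
    show ?case using incl assms by (intro image_eqI[of _ _ "[h]"]) auto
  next
    case (inv h)
    show ?case using inv assms by (intro image_eqI[of _ _ "[h]"]) auto
  next
    case (eng g h)
    then obtain u v where "g = ev u" "h = ev v" "u \<in> lists J" "v \<in> lists J" by auto
    moreover from this have "u \<in> lists S" "v \<in> lists S" using assms by auto
    ultimately show ?case by (intro image_eqI[of _ _ "u @ v"]) auto
  qed
  then show "generate W J \<subseteq> ev ` lists J" by blast
  have "ev u \<in> generate W J" if "u \<in> lists J" for u
    using that by (induction u) (auto intro: generate.intros)
  then show "ev ` lists J \<subseteq> generate W J" by blast
qed

lemma reduced_exists:
  assumes "u \<in> lists S"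
  obtains v where "reduced v" "ev v = ev u"
proof -
  let ?P = "\<lambda>v. v \<in> lists S \<and> ev v = ev u"
  have "?P (arg_min length ?P) \<and> (\<forall>v. ?P v \<longrightarrow> length (arg_min length ?P) \<le> length v)"
    by (rule arg_min_nat_lemma[of ?P u]) (use assms in auto)
  then show ?thesis using that[of "arg_min length ?P"] by (auto simp: reduced_def)
qed

lemma reduced_lists: "reduced u \<Longrightarrow> u \<in> lists S"
  by (simp add: reduced_def)

lemma reduced_length_eq: "\<lbrakk>reduced u; reduced v; ev u = ev v\<rbrakk> \<Longrightarrow> length u = length v"
  by (simp add: reduced_def le_antisym)

lemma reduced_if_length_le:
  "\<lbrakk>reduced u; v \<in> lists S; ev v = ev u; length v \<le> length u\<rbrakk> \<Longrightarrow> reduced v"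
  unfolding reduced_def using le_trans by metis

lemma reduced_rev: "reduced u \<Longrightarrow> reduced (rev u)"
proof -
  assume u: "reduced u"
  have "length u \<le> length v" if v: "v \<in> lists S" "ev v = ev (rev u)" for v
  proof -
    have "ev (rev v) = ev u"
      using v u by (simp add: ev_rev reduced_lists)
    then show ?thesis using u v unfolding reduced_def
      by (metis in_lists_conv_set length_rev set_rev)
  qed
  then show ?thesis using u by (auto simp: reduced_def in_lists_conv_set)
qed

lemma reduced_factor:
  assumes "reduced (x @ u @ y)"
  shows "reduced u"
proof -
  have l: "x \<in> lists S" "u \<in> lists S" "y \<in> lists S"
    using assms by (auto simp: reduced_def)
  have "length u \<le> length v" if "v \<in> lists S" "ev v = ev u" for v
  proof -
    have "ev (x @ v @ y) = ev (x @ u @ y)" using l that by simp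
    moreover have "x @ v @ y \<in> lists S" using l that by simp
    ultimately have "length (x @ u @ y) \<le> length (x @ v @ y)"
      using assms unfolding reduced_def by blast
    then show ?thesis by simp
  qed
  then show ?thesis using l by (simp add: reduced_def)
qed

section \<open>The exchange condition\<close>

text \<open>A relator has even length \<open>2k\<close>, so the parity of the length is an invariant
  of the group element. In \<open>exchange\<close> it sharpens "shorter than \<open>s # u\<close>"
  to "shorter than \<open>u\<close>".\<close>

lemma cong_even_length: "coxeter_cong S m u v \<Longrightarrow> even (length u) \<longleftrightarrow> even (length v)"
proof (induction rule: coxeter_cong.induct)
  case (relation s t k u v)
  have "even (length (concat (replicate k [s, t])))"
    by (induction k) auto
  then show ?case by simp
qed auto

text \<open>On words in the generators these are the reflections \<open>s1\<close>,
  \<open>s1 s2 s1\<close>, \<open>s1 s2 s3 s2 s1\<close>, and so on. They form a list and not a set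
  because their multiplicities modulo 2 carry the argument.\<close>

primrec reflections :: "'a list \<Rightarrow> 'a list" where
  "reflections [] = []"
| "reflections (s # u) = s # map (\<lambda>g. s \<otimes> g \<otimes> s) (reflections u)"

lemma reflections_closed: "u \<in> lists S \<Longrightarrow> set (reflections u) \<subseteq> carrier W"
  by (induction u) auto

lemma reflections_append:
  assumes "u \<in> lists S" "v \<in> lists S"
  shows "reflections (u @ v) =
    reflections u @ map (\<lambda>g. ev u \<otimes> g \<otimes> inv (ev u)) (reflections v)"
  using assms
proof (induction u)
  case Nil
  then show ?case using reflections_closed[of v] by (auto intro!: map_idI[symmetric])
next
  case (Cons s u)
  then show ?case using reflections_closed[of v]
    by (auto simp: inv_mult_group m_assoc subset_iff)
qed

text \<open>The reflections of an alternating word are \<open>s\<close>, \<open>sts\<close>,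
  \<open>ststs\<close>, and so on. Two further letters in front conjugate by \<open>st\<close>,
  which raises the exponent by 2 because \<open>s (st)^-1 = (st) s\<close>.\<close>

lemma reflections_relation:
  assumes st: "s \<in> S" "t \<in> S"
  shows "reflections (concat (replicate k [s, t])) = map (\<lambda>i. (s \<otimes> t) [^] i \<otimes> s) [0..<2 * k]"
proof (induction k)
  case (Suc k)
  note l = alternating_lists[OF st, of k]
  have "map (\<lambda>i. Suc (Suc i)) [0..<2 * k] = map Suc (map Suc [0..<2 * k])"
    by simp
  also have "\<dots> = [Suc (Suc 0)..<Suc (Suc (2 * k))]"
    by (simp only: map_Suc_upt)
  finally have e: "[0..<2 * Suc k] = [0, 1] @ map (\<lambda>i. Suc (Suc i)) [0..<2 * k]"
    by (simp add: upt_conv_Cons del: upt_Suc)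
  have "s \<otimes> t \<otimes> ((s \<otimes> t) [^] i \<otimes> s) \<otimes> inv (s \<otimes> t) = (s \<otimes> t) [^] Suc (Suc i) \<otimes> s" for i :: nat
  proof -
    have "(s \<otimes> t) [^] Suc (Suc i) \<otimes> s = (s \<otimes> t) \<otimes> (s \<otimes> t) [^] i \<otimes> (s \<otimes> t) \<otimes> s"
      using st by (simp only: nat_pow_Suc nat_pow_Suc2[symmetric] m_closed generator_closed)
    then show ?thesis
      using st by (simp add: inv_mult_group m_assoc)
  qed
  moreover have "reflections (concat (replicate (Suc k) [s, t])) =
      [s, s \<otimes> t \<otimes> s] @ map (\<lambda>g. s \<otimes> t \<otimes> g \<otimes> inv (s \<otimes> t)) (reflections (concat (replicate k [s, t])))"
    using reflections_append[of "[s, t]" "concat (replicate k [s, t])"] st l by simp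
  ultimately show ?case
    unfolding Suc.IH e using st by simp
qed simp

text \<open>As \<open>(st)^k = 1\<close>, the \<open>2k\<close> entries \<open>(st)^i s\<close>
  repeat after \<open>k\<close> steps; each reflection thus occurs an even number of times in a
  relator.\<close>

lemma reflections_relation_square:
  assumes st: "s \<in> S" "t \<in> S" and k: "m s t = enat k"
  obtains xs where "reflections (concat (replicate k [s, t])) = xs @ xs"
proof -
  have "ev (concat (replicate i [s, t])) = (s \<otimes> t) [^] i" for i :: nat
  proof (induction i)
    case (Suc i)
    then show ?case using Suc st nat_pow_Suc2[of "s \<otimes> t" i] by (simp add: m_assoc)
  qed simp
  then have p: "(s \<otimes> t) [^] k = \<one>"
    using relation_word[OF st k] by simp
  let ?f = "\<lambda>i::nat. (s \<otimes> t) [^] i \<otimes> s"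
  have "?f (i + k) = ?f i" for i
    using st p by (simp add: nat_pow_mult[symmetric])
  then have "map ?f (map (\<lambda>i. i + k) [0..<k]) = map ?f [0..<k]"
    by simp
  then have "map ?f [k..<k + k] = map ?f [0..<k]"
    by (simp only: map_add_upt)
  then have "map ?f [0..<2 * k] = map ?f [0..<k] @ map ?f [0..<k]"
    by (metis (no_types, lifting) map_append mult_2 upt_add_eq_append zero_le)
  then show ?thesis using reflections_relation[OF st, of k] that by metis
qed

text \<open>An inserted relator is trivial, so it leaves the conjugators of the later letters
  unchanged. Its own contribution is a conjugate of a list \<open>xs @ xs\<close> and does not
  affect parities.\<close>

lemma cong_reflections_even:
  "coxeter_cong S m u v \<Longrightarrow> \<forall>g. even (count_list (reflections u) g) \<longleftrightarrow> even (count_list (reflections v) g)"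
proof (induction rule: coxeter_cong.induct)
  case (relation s t k u v)
  let ?r = "concat (replicate k [s, t])"
  have r: "?r \<in> lists S" using relation by (simp only: alternating_lists)
  have e: "ev ?r = \<one>" using relation relation_word by blast
  have cl: "set (reflections v) \<subseteq> carrier W" "set (reflections ?r) \<subseteq> carrier W"
    using reflections_closed r relation by blast+
  have ra: "reflections (?r @ v) = reflections ?r @ reflections v"
    using relation r cl e by (auto simp: reflections_append subset_iff intro!: map_idI)
  obtain xs where "reflections ?r = xs @ xs"
    using relation reflections_relation_square by blast
  then show ?case using relation r ra by (simp add: reflections_append) blast
qed auto

text \<open>An entry is \<open>x s x^-1\<close> for a splitting \<open>x s y\<close> of the word;
  multiplication by it cancels the letter \<open>s\<close>.\<close>

lemma set_reflectionsD:
  assumes "g \<in> set (reflections u)" "u \<in> lists S"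
  obtains x s y where "u = x @ s # y" "g \<otimes> ev u = ev (x @ y)"
proof -
  have "\<exists>x s y. u = x @ s # y \<and> g \<otimes> ev u = ev (x @ y)"
    using assms
  proof (induction u arbitrary: g)
    case (Cons r u)
    show ?case
    proof (cases "g = r")
      case True
      have "r # u = [] @ r # u \<and> g \<otimes> ev (r # u) = ev ([] @ u)" using Cons.prems True by simp
      then show ?thesis by blast
    next
      case False
      then obtain h where h: "h \<in> set (reflections u)" "g = r \<otimes> h \<otimes> r"
        using Cons.prems by auto
      then obtain x s y where u: "u = x @ s # y" "h \<otimes> ev u = ev (x @ y)"
        using Cons.IH Cons.prems by (metis Cons_in_lists_iff)
      have "h \<in> carrier W" using h reflections_closed Cons.prems by auto
      then have "g \<otimes> ev (r # u) = r \<otimes> (h \<otimes> ev u)"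
        using h Cons.prems by (simp add: m_assoc)
      then have "r # u = (r # x) @ s # y \<and> g \<otimes> ev (r # u) = ev ((r # x) @ y)"
        using u by simp
      then show ?thesis by blast
    qed
  qed simp
  then show ?thesis using that by blast
qed

lemma count_list_conj_generator:
  assumes "s \<in> S" "set xs \<subseteq> carrier W"
  shows "count_list (map (\<lambda>g. s \<otimes> g \<otimes> s) xs) s = count_list xs s"
proof -
  have "s \<otimes> g \<otimes> s = s \<longleftrightarrow> g = s" if "g \<in> carrier W" for g
  proof -
    have "s \<otimes> (s \<otimes> g \<otimes> s) \<otimes> s = g" using that assms by (simp add: m_assoc)
    then show ?thesis using that assms by auto
  qed
  then show ?thesis using assms(2) by (induction xs) auto
qed

text \<open>A reduced word \<open>v\<close> for \<open>s u\<close> is shorter than \<open>u\<close>,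
  so \<open>s v\<close> is a second reduced word for \<open>u\<close>. The reflection
  \<open>s\<close> occurs exactly once for \<open>s v\<close>; by parity it occurs for
  \<open>u\<close>, and deleting the corresponding letter of \<open>u\<close> yields
  \<open>s u\<close>.\<close>

lemma exchange:
  assumes u: "reduced u" and s: "s \<in> S" and n: "\<not> reduced (s # u)"
  obtains x r y where "u = x @ r # y" "ev (s # u) = ev (x @ y)"
proof -
  have ul: "u \<in> lists S" using u by (rule reduced_lists)
  obtain v where v: "reduced v" "ev v = ev (s # u)"
    using reduced_exists[of "s # u"] ul s by auto
  have vl: "v \<in> lists S" using v by (simp add: reduced_lists)
  have "length v < length (s # u)"
    using v n s ul reduced_if_length_le[of v "s # u"] by (metis Cons_in_lists_iff not_le)
  moreover have "even (length v) \<longleftrightarrow> even (length (s # u))"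
    using v vl ul s ev_eq_iff cong_even_length by (metis Cons_in_lists_iff)
  ultimately have len: "length (s # v) \<le> length u"
    by (cases "length v = length u") auto
  have e: "ev (s # v) = ev u" using v s ul by simp
  have sv: "reduced (s # v)"
    using reduced_if_length_le[OF u] len e s vl by (metis Cons_in_lists_iff)
  \<comment> \<open>Otherwise deleting a letter of \<open>v\<close> would give a word for
    \<open>s v\<close> that is two letters shorter.\<close>
  have "s \<notin> set (reflections v)"
  proof
    assume "s \<in> set (reflections v)"
    then obtain x r y where x: "v = x @ r # y" "s \<otimes> ev v = ev (x @ y)"
      using set_reflectionsD vl by blast
    then have "x @ y \<in> lists S" "ev (x @ y) = ev (s # v)" using vl by simp_all
    then have "length (s # v) \<le> length (x @ y)" using sv unfolding reduced_def by metis
    then show False using x by simp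
  qed
  then have "count_list (reflections v) s = 0" by simp
  then have "odd (count_list (reflections (s # v)) s)"
    using count_list_conj_generator[OF s reflections_closed[OF vl]] by simp
  moreover have "coxeter_cong S m (s # v) u"
    using e s vl ul ev_eq_iff by (metis Cons_in_lists_iff)
  ultimately have "odd (count_list (reflections u) s)"
    using cong_reflections_even by blast
  then have "s \<in> set (reflections u)"
    by (metis count_list_0_iff even_zero)
  then show ?thesis
    using set_reflectionsD[OF _ ul] that by (metis ev_Cons)
qed

section \<open>Parabolic subgroups\<close>

text \<open>A word for the same element shorter than \<open>x @ y\<close> would become, with
  \<open>s\<close> in front, a word for \<open>u\<close> shorter than \<open>u\<close>.\<close>

lemma reduced_Cons_delete:
  assumes "reduced u" "s \<in> S" "u = x @ r # y" "ev (s # u) = ev (x @ y)"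
  shows "reduced (x @ y)"
proof -
  have l: "x @ y \<in> lists S" using assms reduced_lists[of u] by simp
  obtain v where v: "reduced v" "ev v = ev (x @ y)" using reduced_exists[OF l] .
  have vl: "v \<in> lists S" using v reduced_lists by blast
  have "ev (s # v) = ev u" using v assms reduced_lists[of u] by (metis ev_Cons generator_cancel ev_closed)
  then have "length u \<le> length (s # v)" using assms vl unfolding reduced_def by (metis Cons_in_lists_iff)
  then have "length (x @ y) \<le> length v" using assms by simp
  then show ?thesis using v l reduced_if_length_le by metis
qed

text \<open>The letters are prefixed one at a time. Where reducedness fails, \<open>exchange\<close>
  only deletes a letter, so no generator outside \<open>J\<close> enters.\<close>

lemma parabolic_reduced_exists:
  assumes J: "J \<subseteq> S" and "u \<in> lists J"
  obtains v where "reduced v" "v \<in> lists J" "ev v = ev u"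
proof -
  have "\<exists>v. reduced v \<and> v \<in> lists J \<and> ev v = ev u"
    using assms(2)
  proof (induction u rule: list.induct)
    case Nil
    have "reduced []" by (simp add: reduced_def)
    then show ?case by (auto intro: exI[of _ "[]"])
  next
    case (Cons s u)
    then obtain v where v: "reduced v" "v \<in> lists J" "ev v = ev u" by auto
    have s: "s \<in> S" using Cons.prems J by auto
    show ?case
    proof (cases "reduced (s # v)")
      case True
      then show ?thesis using v Cons.prems by (intro exI[of _ "s # v"]) auto
    next
      case False
      then obtain x r y where x: "v = x @ r # y" "ev (s # v) = ev (x @ y)"
        using exchange v s by blast
      then have "reduced (x @ y)" using reduced_Cons_delete v s by blast
      then show ?thesis using x v by (intro exI[of _ "x @ y"]) auto
    qed
  qed
  then show ?thesis using that by blast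
qed

lemma generator_reduced:
  assumes "s \<in> S"
  shows "reduced [s]"
proof -
  have "length v \<noteq> 0" if "v \<in> lists S" "ev v = ev [s]" for v
  proof
    assume "length v = 0"
    then have "coxeter_cong S m [] [s]" using that assms ev_eq_iff[of "[]" "[s]"] by simp
    then show False using cong_even_length by fastforce
  qed
  then show ?thesis using assms by (auto simp: reduced_def Suc_le_eq)
qed

lemma generator_in_parabolic:
  assumes J: "J \<subseteq> S" and s: "s \<in> S" "s \<in> ev ` lists J"
  shows "s \<in> J"
proof -
  obtain v where v: "reduced v" "v \<in> lists J" "ev v = s"
    using s(2) parabolic_reduced_exists[OF J] by (metis imageE)
  then have "length v = 1"
    using reduced_length_eq[OF generator_reduced[OF s(1)], of v] s by simp
  then obtain j where "v = [j]" by (auto simp: length_Suc_conv)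
  then show ?thesis using v J by auto
qed

lemma parabolic_mult:
  assumes "J \<subseteq> S" "g \<in> ev ` lists J" "h \<in> ev ` lists J"
  shows "g \<otimes> h \<in> ev ` lists J"
proof -
  obtain u v where "g = ev u" "h = ev v" "u \<in> lists J" "v \<in> lists J" using assms by auto
  moreover from this have "u \<in> lists S" "v \<in> lists S" using assms(1) by auto
  ultimately show ?thesis by (intro image_eqI[of _ _ "u @ v"]) auto
qed

lemma parabolic_inv:
  assumes "J \<subseteq> S" "g \<in> ev ` lists J"
  shows "inv g \<in> ev ` lists J"
proof -
  obtain u where "g = ev u" "u \<in> lists J" using assms by auto
  moreover from this have "u \<in> lists S" using assms(1) by auto
  ultimately show ?thesis by (intro image_eqI[of _ _ "rev u"]) (auto simp: ev_rev)
qed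

text \<open>By \<open>exchange\<close>, a reduced \<open>J\<close>-word \<open>u\<close> for
  \<open>s v\<close> loses one letter and becomes a \<open>J\<close>-word for \<open>v\<close>. So
  \<open>v\<close> is over \<open>J\<close> by induction, and \<open>s = u v^-1\<close> is a
  generator lying in the subgroup.\<close>

lemma reduced_parabolic_lists:
  assumes J: "J \<subseteq> S" and "reduced v" "ev v \<in> ev ` lists J"
  shows "v \<in> lists J"
  using assms(2,3)
proof (induction v)
  case (Cons s v)
  have s: "s \<in> S" and vl: "v \<in> lists S" using reduced_lists[OF Cons.prems(1)] by auto
  have v: "reduced v" using reduced_factor[of "[s]" v "[]"] Cons.prems by simp
  obtain u where u: "reduced u" "u \<in> lists J" "ev u = ev (s # v)"
    using Cons.prems parabolic_reduced_exists[OF J] by (metis imageE)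
  have ul: "u \<in> lists S" using u reduced_lists by blast
  have su: "ev (s # u) = ev v" using u s vl by simp
  have "\<not> reduced (s # u)"
    using reduced_length_eq[OF v, of "s # u"] reduced_length_eq[OF u(1) Cons.prems(1)] su u(3) by auto
  then obtain x r y where x: "u = x @ r # y" "ev (s # u) = ev (x @ y)"
    using exchange u s by blast
  have "ev v \<in> ev ` lists J" using x u su by (intro image_eqI[of _ _ "x @ y"]) auto
  then have vJ: "v \<in> lists J" using Cons.IH v by blast
  have "s = ev u \<otimes> inv (ev v)"
    using u s vl ul by (simp add: m_assoc)
  moreover have "ev u \<otimes> inv (ev v) \<in> ev ` lists J"
    using u vJ by (intro parabolic_mult parabolic_inv J imageI)
  ultimately have "s \<in> J" using generator_in_parabolic[OF J s] by simp
  then show ?case using vJ by simp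
qed simp

lemma carrier_eq_ev: "carrier W = ev ` lists S"
  using generate_eq_ev[of S] generate_S by simp

lemma carrier_parabolic: "J \<subseteq> S \<Longrightarrow> carrier (subgroup_generated W J) = ev ` lists J"
  using generators_closed generate_eq_ev[of J]
  by (simp add: carrier_subgroup_generated inf_absorb2 subset_trans[of J S])

lemma eval_word_parabolic: "eval_word (subgroup_generated W J) u = ev u"
  by (induction u) (auto simp: eval_word_def)

lemma reduced_expression_for_parabolic:
  assumes J: "J \<subseteq> S"
  shows "reduced_expression_for (subgroup_generated W J) J u w \<longleftrightarrow>
    reduced u \<and> ev u = w \<and> w \<in> ev ` lists J"
proof
  assume L: "reduced_expression_for (subgroup_generated W J) J u w"
  then have u: "u \<in> lists J" "ev u = w" "\<And>v. v \<in> lists J \<Longrightarrow> ev v = w \<Longrightarrow> length u \<le> length v"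
    by (auto simp: reduced_expression_for_def expression_for_def eval_word_parabolic)
  obtain v where v: "reduced v" "v \<in> lists J" "ev v = ev u"
    using parabolic_reduced_exists[OF J u(1)] .
  then have "length u \<le> length v" using u by simp
  then have "reduced u" using reduced_if_length_le[OF v(1), of u] v u J by auto
  then show "reduced u \<and> ev u = w \<and> w \<in> ev ` lists J" using u by auto
next
  assume R: "reduced u \<and> ev u = w \<and> w \<in> ev ` lists J"
  then have "u \<in> lists J" using reduced_parabolic_lists[OF J] by simp
  then show "reduced_expression_for (subgroup_generated W J) J u w"
    using R lists_mono[OF J]
    by (auto simp: reduced_expression_for_def expression_for_def eval_word_parabolic reduced_def)
qed

lemma FC_parabolic:
  assumes J: "J \<subseteq> S"
  shows "FC (subgroup_generated W J) J m = FC W S m \<inter> ev ` lists J"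
  using lists_mono[OF J]
  by (auto simp: FC_def reduced_expression_for_parabolic[OF J] reduced_expression_for_iff
      carrier_parabolic[OF J] carrier_eq_ev)

text \<open>Reduced words of an element of a parabolic subgroup are the same in the subgroup and in
  \<open>W\<close>, and rotation keeps their letters. All three sets to be counted can thus be
  studied inside \<open>W\<close>.\<close>

lemma CFC_parabolic:
  assumes J: "J \<subseteq> S"
  shows "CFC (subgroup_generated W J) J m = CFC W S m \<inter> ev ` lists J"
proof -
  have rot: "ev (rotate k u) \<in> ev ` lists J" if "reduced u" "ev u \<in> ev ` lists J" for k u
    using reduced_parabolic_lists[OF J that] by (auto simp: in_lists_conv_set)
  show ?thesis
  proof (intro equalityI subsetI)
    fix w assume "w \<in> CFC (subgroup_generated W J) J m"
    then have w: "w \<in> ev ` lists J" "\<And>u k. \<lbrakk>reduced u; ev u = w\<rbrakk> \<Longrightarrow>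
        ev (rotate k u) \<in> FC W S m \<and> reduced (rotate k u)"
      by (auto simp: CFC_def reduced_expression_for_parabolic[OF J] carrier_parabolic[OF J] FC_parabolic[OF J])
    then show "w \<in> CFC W S m \<inter> ev ` lists J"
      using lists_mono[OF J] by (auto simp: CFC_def reduced_expression_for_iff carrier_eq_ev)
  next
    fix w assume w: "w \<in> CFC W S m \<inter> ev ` lists J"
    then show "w \<in> CFC (subgroup_generated W J) J m"
      using rot
      by (auto simp: CFC_def reduced_expression_for_parabolic[OF J] carrier_parabolic[OF J]
          FC_parabolic[OF J] reduced_expression_for_iff)
  qed
qed

end

section \<open>Commutation classes\<close>

lemma commutation_move_filter:
  assumes "commutation_move m u v"
  shows "filter P u = filter P v \<or> commutation_move m (filter P u) (filter P v)"
  using assms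
proof cases
  case (1 s t x y)
  show ?thesis
  proof (cases "P s \<and> P t")
    case True
    then show ?thesis
      using 1 commutation_move.intros[of m s t "filter P x" "filter P y"] by simp
  qed (use 1 in auto)
qed

lemma commutation_move_filter_clique:
  assumes "commutation_move m u v" "\<And>a b. P a \<Longrightarrow> P b \<Longrightarrow> m a b \<noteq> 2"
  shows "filter P u = filter P v"
  using assms by (induction rule: commutation_move.induct) auto

lemma commutation_move_context:
  assumes "commutation_move m u v"
  shows "commutation_move m (x @ u @ y) (x @ v @ y)"
  using assms
proof cases
  case (1 s t p q)
  then show ?thesis using commutation_move.intros[of m s t "x @ p" "q @ y"] by simp
qed

lemma commutation_move_rev:
  assumes "commutation_move m u v"
  shows "commutation_move m (rev v) (rev u)"
  using assms
proof cases
  case (1 s t p q)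
  then show ?thesis using commutation_move.intros[of m s t "rev q" "rev p"] by simp
qed

text \<open>The third alternative serves reversal, which turns the direction of a move around;
  \<open>m\<close> is not assumed symmetric here.\<close>

lemma commutation_equivalent_map:
  assumes "commutation_equivalent m u v"
    and "\<And>x y. commutation_move m x y \<Longrightarrow> f x = f y \<or> commutation_move m (f x) (f y) \<or> commutation_move m (f y) (f x)"
  shows "commutation_equivalent m (f u) (f v)"
  using assms(1) unfolding commutation_equivalent_def
proof (induction rule: equivclp_induct)
  case (step y z)
  then have "f y = f z \<or> commutation_move m (f y) (f z) \<or> commutation_move m (f z) (f y)"
    using assms(2) by metis
  then have "equivclp (commutation_move m) (f y) (f z)"
    by (auto intro: equivclp_sym)
  then show ?case using step.IH equivclp_trans by metis
qed simp

lemma commutation_equivalent_filter: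
  assumes "commutation_equivalent m u v"
  shows "commutation_equivalent m (filter P u) (filter P v)"
proof (rule commutation_equivalent_map[OF assms, where f = "filter P"])
  fix x y assume "commutation_move m x y"
  then show "filter P x = filter P y \<or> commutation_move m (filter P x) (filter P y)
      \<or> commutation_move m (filter P y) (filter P x)"
    using commutation_move_filter[of m x y P] by blast
qed

text \<open>A move never swaps two letters that both survive the filter. The projection to pairwise
  noncommuting letters is thus an invariant, and it is the means of showing that words are not
  commutation equivalent.\<close>

lemma commutation_equivalent_filter_clique:
  assumes "commutation_equivalent m u v" and clique: "\<And>a b. P a \<Longrightarrow> P b \<Longrightarrow> m a b \<noteq> 2"
  shows "filter P u = filter P v"
  using assms(1) unfolding commutation_equivalent_def
proof (induction rule: equivclp_induct)
  case (step y z)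
  from step.hyps(2) have "filter P y = filter P z"
  proof
    assume "commutation_move m y z"
    from commutation_move_filter_clique[OF this clique] show ?thesis .
  next
    assume "commutation_move m z y"
    from commutation_move_filter_clique[OF this clique] show ?thesis by simp
  qed
  then show ?case using step.IH by simp
qed simp

lemma commutation_equivalent_context:
  assumes "commutation_equivalent m u v"
  shows "commutation_equivalent m (x @ u @ y) (x @ v @ y)"
  by (rule commutation_equivalent_map[OF assms, where f = "\<lambda>z. x @ z @ y"])
    (rule disjI2, rule disjI1, rule commutation_move_context)

lemma commutation_equivalent_rev:
  assumes "commutation_equivalent m u v"
  shows "commutation_equivalent m (rev u) (rev v)"
  by (rule commutation_equivalent_map[OF assms, where f = rev])
    (rule disjI2, rule disjI2, rule commutation_move_rev)

lemma commutation_equivalent_trans: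
  "\<lbrakk>commutation_equivalent m u v; commutation_equivalent m v w\<rbrakk> \<Longrightarrow> commutation_equivalent m u w"
  unfolding commutation_equivalent_def by (rule equivclp_trans)

lemma commutation_equivalent_sym:
  "commutation_equivalent m u v \<Longrightarrow> commutation_equivalent m v u"
  unfolding commutation_equivalent_def by (rule equivclp_sym)

lemma commutation_equivalent_commute:
  "\<forall>c\<in>set u. m t c = 2 \<Longrightarrow> commutation_equivalent m (t # u) (u @ [t])"
proof (induction u)
  case Nil
  then show ?case by (simp add: commutation_equivalent_def)
next
  case (Cons c u)
  have "commutation_move m ([] @ [t, c] @ u) ([] @ [c, t] @ u)"
    using Cons.prems by (intro commutation_move.intros) simp
  then have "commutation_equivalent m (t # c # u) (c # t # u)"
    by (simp add: commutation_equivalent_def r_into_equivclp)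
  moreover have "commutation_equivalent m ([c] @ (t # u) @ []) ([c] @ (u @ [t]) @ [])"
    using Cons by (intro commutation_equivalent_context) simp
  ultimately show ?case using commutation_equivalent_trans by fastforce
qed

text \<open>Reduces the rotations of a word containing \<open>t\<close> to rotations of the word
  without it. The amounts \<open>k\<close> and \<open>j\<close> differ once \<open>t\<close> itself
  has been moved to the end.\<close>

lemma rotate_insert:
  "\<exists>p q j. rotate k (a @ t # b) = p @ t # q \<and> p @ q = rotate j (a @ b)"
proof (induction k)
  case 0
  have "a @ b = rotate 0 (a @ b)" by simp
  then show ?case by (metis rotate0 id_apply)
next
  case (Suc k)
  then obtain p q j where pq: "rotate k (a @ t # b) = p @ t # q" "p @ q = rotate j (a @ b)"
    by blast
  show ?case
  proof (cases p)
    case Nil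
    then have "rotate (Suc k) (a @ t # b) = q @ t # []" "q @ [] = rotate j (a @ b)"
      using pq by simp_all
    then show ?thesis by blast
  next
    case (Cons c p')
    then have "rotate (Suc k) (a @ t # b) = p' @ t # (q @ [c])"
      using pq by simp
    moreover have "p' @ (q @ [c]) = rotate (Suc j) (a @ b)"
      using pq(2)[symmetric] Cons by simp
    ultimately show ?thesis by blast
  qed
qed

lemma count_list_rotate [simp]: "count_list (rotate k u) a = count_list u a"
proof (induction k)
  case (Suc k)
  have "count_list (rotate1 v) a = count_list v a" for v :: "'a list"
    by (cases v) auto
  then show ?case using Suc by simp
qed simp

context coxeter_group
begin

section \<open>Fully commutative words\<close>

text \<open>A property of words, since \<open>CFC\<close> speaks about rotated words;
  \<open>fc_word_iff\<close> links it to \<open>FC\<close>.\<close>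

definition fc_word :: "'a list \<Rightarrow> bool" where
  "fc_word u \<longleftrightarrow> reduced u \<and> (\<forall>v. reduced v \<longrightarrow> ev v = ev u \<longrightarrow> commutation_equivalent m u v)"

lemma fc_word_iff: "fc_word u \<longleftrightarrow> reduced u \<and> ev u \<in> FC W S m"
proof
  assume u: "fc_word u"
  then have "ev u \<in> carrier W" by (simp add: fc_word_def reduced_lists)
  then show "reduced u \<and> ev u \<in> FC W S m"
    using u commutation_equivalent_trans commutation_equivalent_sym
    unfolding fc_word_def FC_def reduced_expression_for_iff by blast
qed (auto simp: fc_word_def FC_def reduced_expression_for_iff)

lemma CFC_iff:
  "w \<in> CFC W S m \<longleftrightarrow> w \<in> carrier W \<and> (\<forall>u k. reduced u \<longrightarrow> ev u = w \<longrightarrow> fc_word (rotate k u))"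
  by (auto simp: CFC_def fc_word_iff reduced_expression_for_iff)

lemma fc_word_reduced: "fc_word u \<Longrightarrow> reduced u"
  by (simp add: fc_word_def)

lemma fc_word_same_ev:
  "\<lbrakk>fc_word u; v \<in> lists S; ev v = ev u; length v = length u\<rbrakk> \<Longrightarrow> fc_word v"
  using reduced_if_length_le[of u v] by (simp add: fc_word_iff)

lemma fc_word_filter_clique:
  assumes "fc_word u" "v \<in> lists S" "ev v = ev u" "length v = length u"
    and "\<And>a b. P a \<Longrightarrow> P b \<Longrightarrow> m a b \<noteq> 2"
  shows "filter P u = filter P v"
proof -
  have "reduced v" using assms fc_word_same_ev fc_word_reduced by blast
  then show ?thesis
    using assms commutation_equivalent_filter_clique[of m u v P] by (simp add: fc_word_def)
qed

lemma m_two_sym: "\<lbrakk>s \<in> S; t \<in> S\<rbrakk> \<Longrightarrow> m s t = 2 \<longleftrightarrow> m t s = 2"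
  using m_sym by metis

lemma commute:
  assumes "s \<in> S" "t \<in> S" "m s t = 2"
  shows "s \<otimes> t = t \<otimes> s"
proof -
  have "ev (concat (replicate 2 [s, t])) = \<one>"
    using assms relation_word[of s t 2] by (simp add: numeral_eq_enat)
  then have "(s \<otimes> t) \<otimes> (s \<otimes> t) = \<one>"
    using assms by (simp add: numeral_eq_Suc m_assoc)
  then have "inv (s \<otimes> t) = s \<otimes> t"
    using assms inv_equality by simp
  then show ?thesis using assms by (simp add: inv_mult_group)
qed

lemma commute_word:
  assumes "t \<in> S" "u \<in> lists S" "\<forall>c\<in>set u. m c t = 2"
  shows "t \<otimes> ev u = ev u \<otimes> t"
  using assms(2,3)
proof (induction u rule: list.induct)
  case (Cons c u)
  then have c: "c \<in> S" "u \<in> lists S" "t \<otimes> c = c \<otimes> t" using commute[of c t] assms(1) by auto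
  then have "t \<otimes> ev (c # u) = c \<otimes> (t \<otimes> ev u)" using assms(1) by (simp flip: m_assoc)
  then show ?case using Cons c assms(1) by (simp add: m_assoc)
qed (use assms in simp)

section \<open>Braid relations and the patterns they exclude from FC words\<close>

lemma braid3:
  assumes "a \<in> S" "b \<in> S" "m a b = 3"
  shows "ev [a, b, a] = ev [b, a, b]"
proof -
  have "ev (concat (replicate 3 [a, b])) = \<one>"
    using assms relation_word[of a b 3] by (simp add: numeral_eq_enat)
  then have "ev [a, b, a] \<otimes> ev [b, a, b] = \<one>"
    using assms by (simp add: numeral_eq_Suc m_assoc)
  then have "inv (ev [b, a, b]) = ev [a, b, a]"
    using assms by (intro inv_equality) simp_all
  then show ?thesis using assms ev_rev[of "[b, a, b]"] by simp
qed

lemma braid4: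
  assumes "a \<in> S" "b \<in> S" "m a b = 4"
  shows "ev [a, b, a, b] = ev [b, a, b, a]"
proof -
  have "ev (concat (replicate 4 [a, b])) = \<one>"
    using assms relation_word[of a b 4] by (simp add: numeral_eq_enat)
  then have "ev [a, b, a, b] \<otimes> ev [a, b, a, b] = \<one>"
    using assms by (simp add: numeral_eq_Suc m_assoc)
  then have "inv (ev [a, b, a, b]) = ev [a, b, a, b]"
    using assms by (intro inv_equality) simp_all
  then show ?thesis using assms ev_rev[of "[a, b, a, b]"] by simp
qed

lemma braid5:
  assumes "a \<in> S" "b \<in> S" "m a b = 5"
  shows "ev [a, b, a, b, a] = ev [b, a, b, a, b]"
proof -
  have "ev (concat (replicate 5 [a, b])) = \<one>"
    using assms relation_word[of a b 5] by (simp add: numeral_eq_enat)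
  then have "ev [a, b, a, b, a] \<otimes> ev [b, a, b, a, b] = \<one>"
    using assms by (simp add: numeral_eq_Suc m_assoc)
  then have "inv (ev [b, a, b, a, b]) = ev [a, b, a, b, a]"
    using assms by (intro inv_equality) simp_all
  then show ?thesis using assms ev_rev[of "[b, a, b, a, b]"] by simp
qed

text \<open>The letters of \<open>w\<close> can be moved out of the way, and then the two
  \<open>a\<close> cancel.\<close>

lemma reduced_no_square:
  assumes "reduced (x @ [a] @ w @ [a] @ y)" "\<forall>c\<in>set w. m c a = 2"
  shows False
proof -
  have l: "x \<in> lists S" "a \<in> S" "w \<in> lists S" "y \<in> lists S"
    using reduced_lists[OF assms(1)] by auto
  have "a \<otimes> (ev w \<otimes> (a \<otimes> ev y)) = (a \<otimes> ev w) \<otimes> (a \<otimes> ev y)"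
    using l by (simp add: m_assoc)
  also have "\<dots> = ev w \<otimes> ev y"
    using l commute_word[OF l(2,3) assms(2)] by (simp add: m_assoc)
  finally have "ev (x @ w @ y) = ev (x @ [a] @ w @ [a] @ y)" using l by simp
  moreover have "x @ w @ y \<in> lists S" using l by simp
  ultimately have "length (x @ [a] @ w @ [a] @ y) \<le> length (x @ w @ y)"
    using assms(1) unfolding reduced_def by blast
  then show False by simp
qed

lemma fc_word_filter_pair:
  assumes fc: "fc_word u" and v: "v \<in> lists S" "ev v = ev u" "length v = length u"
    and ab: "a \<in> S" "b \<in> S" "m a b \<noteq> 2"
  shows "filter (\<lambda>c. c = a \<or> c = b) u = filter (\<lambda>c. c = a \<or> c = b) v"
proof -
  have "m a a \<noteq> 2" "m b b \<noteq> 2" "m b a \<noteq> 2"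
    using ab m_self m_two_sym by (auto simp: one_enat_def numeral_eq_enat)
  then show ?thesis
    using ab fc v by (intro fc_word_filter_clique) auto
qed

lemma filter_commuting:
  assumes "a \<in> S" "b \<in> S" "m a b \<noteq> 2" "\<forall>c\<in>set w. m c a = 2"
  shows "filter (\<lambda>c. c = a \<or> c = b) w = []"
  using assms m_self[of a] m_two_sym[of a b]
  by (auto simp: filter_empty_conv one_enat_def numeral_eq_enat)

text \<open>Moving \<open>w1\<close> to the left and \<open>w2\<close> to the right produces the
  factor \<open>aba\<close>. Replacing it by \<open>bab\<close> gives another word of the same
  length whose projection to \<open>{a, b}\<close> differs, which FC forbids.\<close>

lemma fc_word_no_braid3:
  assumes fc: "fc_word (x @ [a] @ w1 @ [b] @ w2 @ [a] @ y)" and m3: "m a b = 3"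
    and w1: "\<forall>c\<in>set w1. m c a = 2" and w2: "\<forall>c\<in>set w2. m c a = 2"
  shows False
proof -
  let ?u = "x @ [a] @ w1 @ [b] @ w2 @ [a] @ y" and ?v = "x @ w1 @ [b, a, b] @ w2 @ y"
  have l: "x \<in> lists S" "a \<in> S" "b \<in> S" "w1 \<in> lists S" "w2 \<in> lists S" "y \<in> lists S"
    using reduced_lists[OF fc_word_reduced[OF fc]] by auto
  have c: "a \<otimes> ev w1 = ev w1 \<otimes> a" "a \<otimes> ev w2 = ev w2 \<otimes> a"
    by (intro commute_word; use l w1 w2 in simp)+
  have ne: "a \<noteq> b" using m3 m_self[OF l(2)] by (auto simp: one_enat_def numeral_eq_enat)
  have "ev ?u = ev x \<otimes> (a \<otimes> ev w1) \<otimes> b \<otimes> (ev w2 \<otimes> a) \<otimes> ev y"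
    using l by (simp add: m_assoc)
  also have "\<dots> = ev x \<otimes> (ev w1 \<otimes> a) \<otimes> b \<otimes> (a \<otimes> ev w2) \<otimes> ev y"
    by (simp only: c)
  also have "\<dots> = ev x \<otimes> ev w1 \<otimes> ev [a, b, a] \<otimes> ev w2 \<otimes> ev y"
    using l by (simp add: m_assoc)
  also have "\<dots> = ev ?v"
    unfolding braid3[OF l(2,3) m3] using l by (simp add: m_assoc)
  finally have e: "ev ?v = ev ?u" by simp
  have n: "m a b \<noteq> 2" using m3 by (simp add: numeral_eq_enat)
  note f = w1[THEN filter_commuting[OF l(2,3) n]] w2[THEN filter_commuting[OF l(2,3) n]]
  have "filter (\<lambda>c. c = a \<or> c = b) ?u = filter (\<lambda>c. c = a \<or> c = b) ?v"
    by (rule fc_word_filter_pair[OF fc _ e _ l(2,3) n]) (use l in simp_all)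
  then show False using ne by (simp add: f)
qed

text \<open>The outer letters move inwards, so \<open>w1\<close> has to commute only with
  \<open>a\<close> and \<open>w3\<close> only with \<open>b\<close>; the middle segment
  \<open>w2\<close> has to pass both.\<close>

lemma fc_word_no_braid4:
  assumes fc: "fc_word (x @ [a] @ w1 @ [b] @ w2 @ [a] @ w3 @ [b] @ y)" and m4: "m a b = 4"
    and w1: "\<forall>c\<in>set w1. m c a = 2" and w2: "\<forall>c\<in>set w2. m c a = 2 \<and> m c b = 2"
    and w3: "\<forall>c\<in>set w3. m c b = 2"
  shows False
proof -
  let ?u = "x @ [a] @ w1 @ [b] @ w2 @ [a] @ w3 @ [b] @ y"
  let ?v = "x @ w1 @ [b, a, b, a] @ w2 @ w3 @ y"
  have l: "x \<in> lists S" "a \<in> S" "b \<in> S" "w1 \<in> lists S" "w2 \<in> lists S" "w3 \<in> lists S" "y \<in> lists S"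
    using reduced_lists[OF fc_word_reduced[OF fc]] by auto
  have c: "a \<otimes> ev w1 = ev w1 \<otimes> a" "a \<otimes> ev w2 = ev w2 \<otimes> a" "b \<otimes> ev w2 = ev w2 \<otimes> b" "b \<otimes> ev w3 = ev w3 \<otimes> b"
    by (intro commute_word; use l w1 w2 w3 in simp)+
  have ne: "a \<noteq> b" using m4 m_self[OF l(2)] by (auto simp: one_enat_def numeral_eq_enat)
  have "ev ?u = ev x \<otimes> (a \<otimes> ev w1) \<otimes> b \<otimes> (ev w2 \<otimes> a) \<otimes> (ev w3 \<otimes> b) \<otimes> ev y"
    using l by (simp add: m_assoc)
  also have "\<dots> = ev x \<otimes> (ev w1 \<otimes> a) \<otimes> b \<otimes> (a \<otimes> ev w2) \<otimes> (b \<otimes> ev w3) \<otimes> ev y"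
    by (simp only: c)
  also have "\<dots> = ev x \<otimes> ev w1 \<otimes> a \<otimes> b \<otimes> a \<otimes> (ev w2 \<otimes> b) \<otimes> ev w3 \<otimes> ev y"
    using l by (simp add: m_assoc)
  also have "\<dots> = ev x \<otimes> ev w1 \<otimes> a \<otimes> b \<otimes> a \<otimes> (b \<otimes> ev w2) \<otimes> ev w3 \<otimes> ev y"
    by (simp only: c)
  also have "\<dots> = ev x \<otimes> ev w1 \<otimes> ev [a, b, a, b] \<otimes> ev w2 \<otimes> ev w3 \<otimes> ev y"
    using l by (simp add: m_assoc)
  also have "\<dots> = ev ?v"
    unfolding braid4[OF l(2,3) m4] using l by (simp add: m_assoc)
  finally have e: "ev ?v = ev ?u" by simp
  have n: "m a b \<noteq> 2" "m b a \<noteq> 2" using m4 m_sym l by (simp_all add: numeral_eq_enat)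
  have f3: "filter (\<lambda>c. c = a \<or> c = b) w3 = []"
    using filter_commuting[OF l(3,2) n(2) w3] by (simp add: disj_commute)
  have f2: "filter (\<lambda>c. c = a \<or> c = b) w2 = []"
    using filter_commuting[OF l(2,3) n(1)] w2 by blast
  note f = f2 f3 w1[THEN filter_commuting[OF l(2,3) n(1)]]
  have "filter (\<lambda>c. c = a \<or> c = b) ?u = filter (\<lambda>c. c = a \<or> c = b) ?v"
    by (rule fc_word_filter_pair[OF fc _ e _ l(2,3) n(1)]) (use l in simp_all)
  then show False using ne by (simp add: f)
qed

text \<open>As for label 4; here \<open>w2\<close> leaves to the left and \<open>w3\<close> to the
  right.\<close>

lemma fc_word_no_braid5:
  assumes fc: "fc_word (x @ [a] @ w1 @ [b] @ w2 @ [a] @ w3 @ [b] @ w4 @ [a] @ y)" and m5: "m a b = 5"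
    and w1: "\<forall>c\<in>set w1. m c a = 2" and w2: "\<forall>c\<in>set w2. m c a = 2 \<and> m c b = 2"
    and w3: "\<forall>c\<in>set w3. m c a = 2 \<and> m c b = 2" and w4: "\<forall>c\<in>set w4. m c a = 2"
  shows False
proof -
  let ?u = "x @ [a] @ w1 @ [b] @ w2 @ [a] @ w3 @ [b] @ w4 @ [a] @ y"
  let ?v = "x @ w1 @ w2 @ [b, a, b, a, b] @ w3 @ w4 @ y"
  have l: "x \<in> lists S" "a \<in> S" "b \<in> S" "w1 \<in> lists S" "w2 \<in> lists S" "w3 \<in> lists S" "w4 \<in> lists S"
    "y \<in> lists S"
    using reduced_lists[OF fc_word_reduced[OF fc]] by auto
  have c: "a \<otimes> ev w1 = ev w1 \<otimes> a" "a \<otimes> ev w2 = ev w2 \<otimes> a" "b \<otimes> ev w2 = ev w2 \<otimes> b"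
    "a \<otimes> ev w3 = ev w3 \<otimes> a" "b \<otimes> ev w3 = ev w3 \<otimes> b" "a \<otimes> ev w4 = ev w4 \<otimes> a"
    by (intro commute_word; use l w1 w2 w3 w4 in simp)+
  have ne: "a \<noteq> b" using m5 m_self[OF l(2)] by (auto simp: one_enat_def numeral_eq_enat)
  have "ev ?u = ev x \<otimes> (a \<otimes> ev w1) \<otimes> (b \<otimes> ev w2) \<otimes> a \<otimes> (ev w3 \<otimes> b) \<otimes> (ev w4 \<otimes> a) \<otimes> ev y"
    using l by (simp add: m_assoc)
  also have "\<dots> = ev x \<otimes> (ev w1 \<otimes> a) \<otimes> (ev w2 \<otimes> b) \<otimes> a \<otimes> (b \<otimes> ev w3) \<otimes> (a \<otimes> ev w4) \<otimes> ev y"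
    by (simp only: c)
  also have "\<dots> = ev x \<otimes> ev w1 \<otimes> (a \<otimes> ev w2) \<otimes> b \<otimes> a \<otimes> b \<otimes> (ev w3 \<otimes> a) \<otimes> ev w4 \<otimes> ev y"
    using l by (simp add: m_assoc)
  also have "\<dots> = ev x \<otimes> ev w1 \<otimes> (ev w2 \<otimes> a) \<otimes> b \<otimes> a \<otimes> b \<otimes> (a \<otimes> ev w3) \<otimes> ev w4 \<otimes> ev y"
    by (simp only: c)
  also have "\<dots> = ev x \<otimes> ev w1 \<otimes> ev w2 \<otimes> ev [a, b, a, b, a] \<otimes> ev w3 \<otimes> ev w4 \<otimes> ev y"
    using l by (simp add: m_assoc)
  also have "\<dots> = ev ?v"
    unfolding braid5[OF l(2,3) m5] using l by (simp add: m_assoc)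
  finally have e: "ev ?v = ev ?u" by simp
  have n: "m a b \<noteq> 2" using m5 by (simp add: numeral_eq_enat)
  have "\<forall>c\<in>set w2. m c a = 2" "\<forall>c\<in>set w3. m c a = 2" using w2 w3 by auto
  note f = this[THEN filter_commuting[OF l(2,3) n]]
    w1[THEN filter_commuting[OF l(2,3) n]] w4[THEN filter_commuting[OF l(2,3) n]]
  have "filter (\<lambda>c. c = a \<or> c = b) ?u = filter (\<lambda>c. c = a \<or> c = b) ?v"
    by (rule fc_word_filter_pair[OF fc _ e _ l(2,3) n]) (use l in simp_all)
  then show False using ne by (simp add: f)
qed

section \<open>Reversal of words and inverses\<close>

lemma fc_word_rev:
  assumes "fc_word u"
  shows "fc_word (rev u)"
proof -
  have "commutation_equivalent m (rev u) v" if v: "reduced v" "ev v = ev (rev u)" for v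
  proof -
    have "ev (rev v) = ev u"
      using v reduced_lists[OF v(1)] reduced_lists[OF fc_word_reduced[OF assms]] by (simp add: ev_rev)
    then have "commutation_equivalent m u (rev v)"
      using assms reduced_rev[OF v(1)] by (simp add: fc_word_def)
    from commutation_equivalent_rev[OF this] show ?thesis by simp
  qed
  then show ?thesis
    using reduced_rev[OF fc_word_reduced[OF assms]] by (simp add: fc_word_def)
qed

text \<open>A rotation of a reversed word is a reversed rotation. This symmetry later derives right
  multiplication by \<open>t\<close> from left multiplication.\<close>

lemma CFC_inv:
  assumes "w \<in> CFC W S m"
  shows "inv w \<in> CFC W S m"
proof -
  have w: "w \<in> carrier W" using assms CFC_iff by blast
  have "fc_word (rotate k u)" if u: "reduced u" "ev u = inv w" for u k
  proof -
    have "reduced (rev u)" "ev (rev u) = w"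
      using u w reduced_rev reduced_lists[OF u(1)] by (simp_all add: ev_rev)
    then have "fc_word (rotate j (rev u))" for j
      using assms CFC_iff by blast
    then have "fc_word (rev (rotate (length (rev u) - k mod length (rev u)) (rev u)))"
      by (rule fc_word_rev)
    then show ?thesis using rotate_rev[of k "rev u"] by simp
  qed
  then show ?thesis using w CFC_iff by blast
qed

end

section \<open>A leaf with label 3\<close>

locale coxeter_leaf = coxeter_group +
  fixes s t
  assumes s: "s \<in> S" and t: "t \<in> S" and m_st: "m s t = 3"
    and t_leaf: "\<And>r. \<lbrakk>r \<in> S; r \<noteq> s; r \<noteq> t\<rbrakk> \<Longrightarrow> m r t = 2"
begin

abbreviation J :: "'a set" where
  "J \<equiv> S - {t}"

abbreviation K :: "'a set" where
  "K \<equiv> S - {t} - {s}"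

lemma J_subset: "J \<subseteq> S" and K_subset: "K \<subseteq> S"
  by auto

lemma s_neq_t: "s \<noteq> t"
  using m_st m_self[OF s] by (auto simp: one_enat_def numeral_eq_enat)

lemma lists_J: "u \<in> lists J \<Longrightarrow> u \<in> lists S"
  by auto

lemma parabolic_closed: "w \<in> ev ` lists J \<Longrightarrow> w \<in> carrier W"
  using lists_J by (blast intro: ev_closed)

lemma s_t_not_commute: "s \<otimes> t \<noteq> t \<otimes> s"
proof
  assume c: "s \<otimes> t = t \<otimes> s"
  have "s \<otimes> (t \<otimes> s) = t" by (simp add: c[symmetric] s t)
  moreover have "t \<otimes> (s \<otimes> t) = s" by (simp add: c s t)
  ultimately have "t = s"
    using braid3[OF s t m_st] s t by simp
  then show False using s_neq_t by simp
qed

lemma commute_without_s: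
  assumes "u \<in> lists J" "s \<notin> set u"
  shows "t \<otimes> ev u = ev u \<otimes> t"
  by (rule commute_word) (use assms t t_leaf in auto)

lemma t_not_parabolic:
  assumes "w \<in> ev ` lists J"
  shows "t \<otimes> w \<notin> ev ` lists J"
proof
  assume tw: "t \<otimes> w \<in> ev ` lists J"
  have "(t \<otimes> w) \<otimes> inv w \<in> ev ` lists J"
    by (rule parabolic_mult[OF J_subset tw parabolic_inv[OF J_subset assms]])
  moreover have "w \<in> carrier W" using assms by (rule parabolic_closed)
  ultimately have "t \<in> ev ` lists J" using t by (simp add: m_assoc)
  then show False using generator_in_parabolic[OF J_subset t] by simp
qed

text \<open>The word \<open>t # v\<close> represents \<open>w\<close> but is not over
  \<open>J\<close>, so it is not reduced. \<open>exchange\<close> deletes one letter of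
  \<open>v\<close> and leaves a reduced \<open>J\<close>-word for \<open>w\<close>; as
  \<open>v\<close> is not over \<open>J\<close>, the deleted letter is \<open>t\<close>.\<close>

lemma reduced_t_mult:
  assumes w: "w \<in> ev ` lists J" and v: "reduced v" "ev v = t \<otimes> w"
  obtains a b where "v = a @ t # b" "a \<in> lists J" "b \<in> lists J" "reduced (a @ b)" "ev (a @ b) = w"
proof -
  have "w \<in> carrier W" using w by (rule parabolic_closed)
  then have tv: "ev (t # v) = w" using v t by simp
  have "t # v \<notin> lists J" by simp
  then have "\<not> reduced (t # v)"
    using reduced_parabolic_lists[OF J_subset] tv w by metis
  then obtain a r b where ab: "v = a @ r # b" "ev (t # v) = ev (a @ b)"
    using exchange[OF v(1) t] by blast
  have red: "reduced (a @ b)"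
    using reduced_Cons_delete[OF v(1) t ab] .
  have abJ: "a @ b \<in> lists J"
    using reduced_parabolic_lists[OF J_subset red] ab tv w by simp
  have "v \<notin> lists J"
    using t_not_parabolic[OF w] v by (metis imageI)
  moreover have "r \<in> S" using ab reduced_lists[OF v(1)] by simp
  ultimately have "r = t" using ab abJ by auto
  then show ?thesis using that ab abJ red tv by simp
qed

lemma reduced_Cons_t:
  assumes u: "reduced u" "u \<in> lists J"
  shows "reduced (t # u)"
proof -
  have l: "t # u \<in> lists S" using t u lists_J by simp
  obtain v where v: "reduced v" "ev v = ev (t # u)"
    using reduced_exists[OF l] .
  then have "ev v = t \<otimes> ev u" by simp
  from reduced_t_mult[OF imageI[OF u(2)] v(1) this]
  obtain a b where ab: "v = a @ t # b" "reduced (a @ b)" "ev (a @ b) = ev u" .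
  then have "length (t # u) \<le> length v"
    using reduced_length_eq[OF u(1) ab(2)] by simp
  then show ?thesis using reduced_if_length_le[OF v(1) l] v by simp
qed

text \<open>A single letter is a clique, so its multiplicity is the same in all reduced words of an
  FC element.\<close>

lemma fc_word_count:
  assumes "fc_word u" "reduced v" "ev v = ev u"
  shows "count_list v r = count_list u r"
proof (cases "r \<in> S")
  case True
  have "commutation_equivalent m u v" using assms by (simp add: fc_word_def)
  moreover have "m r r \<noteq> 2" using m_self[OF True] by (simp add: one_enat_def numeral_eq_enat)
  ultimately have "filter (\<lambda>c. r = c) u = filter (\<lambda>c. r = c) v"
    by (intro commutation_equivalent_filter_clique[of m]) auto
  then show ?thesis by (metis count_list_eq_length_filter)
next
  case False
  then show ?thesis
    using assms reduced_lists[of u] reduced_lists[of v] fc_word_reduced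
    by (metis count_notin in_listsD)
qed

text \<open>Every reduced word of \<open>t u\<close> is \<open>a t b\<close> with \<open>ab\<close>
  a reduced word for \<open>u\<close>, and cancelling \<open>b\<close> shows that \<open>t\<close>
  commutes with the value of \<open>a\<close>. If \<open>a\<close> were \<open>c s d\<close>, its
  only \<open>s\<close> being the one shown, cancelling \<open>c\<close> and \<open>d\<close> would
  give \<open>ts = st\<close>. So \<open>a\<close> is free of \<open>s\<close>, and commutations
  take \<open>t\<close> to the front.\<close>

lemma fc_word_Cons_t:
  assumes u: "fc_word u" "u \<in> lists J" "count_list u s \<le> 1"
  shows "fc_word (t # u)"
proof -
  have "commutation_equivalent m (t # u) v" if v: "reduced v" "ev v = ev (t # u)" for v
  proof -
    obtain a b where ab: "v = a @ t # b" "a \<in> lists J" "b \<in> lists J" "reduced (a @ b)" "ev (a @ b) = ev u"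
      using reduced_t_mult[of "ev u" v] u v by auto
    have l: "a \<in> lists S" "b \<in> lists S" using ab lists_J by auto
    have "t \<otimes> (ev a \<otimes> ev b) = ev a \<otimes> (t \<otimes> ev b)"
      using v ab l t by simp
    then have ta: "t \<otimes> ev a = ev a \<otimes> t"
      using l t by (simp flip: m_assoc)
    have "s \<notin> set a"
    proof
      assume "s \<in> set a"
      then obtain c d where cd: "a = c @ s # d" "s \<notin> set c"
        by (meson split_list_first)
      have "count_list (a @ b) s \<le> 1" using fc_word_count[OF u(1) ab(4,5), of s] u(3) by simp
      then have "s \<notin> set d" using cd by (auto simp: count_list_0_iff)
      have "c \<in> lists J" "d \<in> lists J" using cd(1) ab(2) by auto
      then have c: "c \<in> lists S" "t \<otimes> ev c = ev c \<otimes> t" and d: "d \<in> lists S" "t \<otimes> ev d = ev d \<otimes> t"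
        using cd(2) \<open>s \<notin> set d\<close> lists_J commute_without_s by blast+
      have "ev c \<otimes> ((t \<otimes> s) \<otimes> ev d) = (ev c \<otimes> t) \<otimes> (s \<otimes> ev d)"
        using c d s t by (simp add: m_assoc)
      also have "\<dots> = t \<otimes> ev a" using c d s t cd by (simp add: m_assoc flip: c(2))
      also have "\<dots> = ev c \<otimes> (s \<otimes> (ev d \<otimes> t))" using ta c d s t cd by (simp add: m_assoc)
      also have "\<dots> = ev c \<otimes> ((s \<otimes> t) \<otimes> ev d)" using c d s t by (simp add: m_assoc flip: d(2))
      finally have "t \<otimes> s = s \<otimes> t"
        using c(1) d(1) s t by simp
      then show False using s_t_not_commute by simp
    qed
    have "m t r = 2" if "r \<in> set a" for r
    proof -
      have "r \<in> S" "r \<noteq> t" "r \<noteq> s" using that ab \<open>s \<notin> set a\<close> by auto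
      then show ?thesis using t_leaf m_sym[OF t] by simp
    qed
    then have "commutation_equivalent m ([] @ (t # a) @ b) ([] @ (a @ [t]) @ b)"
      by (intro commutation_equivalent_context commutation_equivalent_commute ballI)
    then have "commutation_equivalent m (t # a @ b) v" using ab(1) by simp
    moreover have "commutation_equivalent m u (a @ b)"
      using u(1) ab by (simp add: fc_word_def)
    then have "commutation_equivalent m ([t] @ u @ []) ([t] @ (a @ b) @ [])"
      by (rule commutation_equivalent_context)
    then have "commutation_equivalent m (t # u) (t # a @ b)" by simp
    ultimately show ?thesis using commutation_equivalent_trans by blast
  qed
  then show ?thesis
    using reduced_Cons_t[OF fc_word_reduced[OF u(1)] u(2)] unfolding fc_word_def by blast
qed

text \<open>With at most one \<open>s\<close>, one side of the insertion point is free of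
  \<open>s\<close>, so \<open>t\<close> can be moved there to the front or to the end; the end is
  treated by reversal.\<close>

lemma fc_word_insert_t:
  assumes fc: "fc_word (p @ q)" and J: "p \<in> lists J" "q \<in> lists J" and c: "count_list (p @ q) s \<le> 1"
  shows "fc_word (p @ t # q)"
proof -
  have l: "p \<in> lists S" "q \<in> lists S" using J lists_J by auto
  have "s \<notin> set p \<or> s \<notin> set q"
    using c by (auto simp: count_list_0_iff[symmetric] simp del: count_list_0_iff)
  then show ?thesis
  proof
    assume "s \<notin> set p"
    then have "ev (p @ t # q) = ev (t # p @ q)"
      using commute_without_s[OF J(1)] l t by (simp flip: m_assoc)
    moreover have "fc_word (t # p @ q)"
      using fc_word_Cons_t[OF fc] J c by simp
    ultimately show ?thesis using fc_word_same_ev[of "t # p @ q"] l t by simp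
  next
    assume "s \<notin> set q"
    have "rev (p @ q) \<in> lists J" using J unfolding in_lists_conv_set by (simp add: ball_Un)
    then have "fc_word (t # rev (p @ q))"
      using fc_word_Cons_t[OF fc_word_rev[OF fc]] c by simp
    from fc_word_rev[OF this] have "fc_word (p @ q @ [t])" by simp
    moreover have "ev (p @ t # q) = ev (p @ q @ [t])"
      using commute_without_s[OF J(2) \<open>s \<notin> set q\<close>] l t by simp
    ultimately show ?thesis using fc_word_same_ev[of "p @ q @ [t]"] l t by simp
  qed
qed

text \<open>A reduced word \<open>v\<close> for the same element can also be prefixed by
  \<open>t\<close>. Erasing \<open>t\<close> from a chain of moves between \<open>t # u\<close> and
  \<open>t # v\<close> leaves one between \<open>u\<close> and \<open>v\<close>.\<close>

lemma fc_word_tl_t: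
  assumes fc: "fc_word (t # u)" and u: "u \<in> lists J"
  shows "fc_word u"
proof -
  have red: "reduced u"
    using reduced_factor[of "[t]" u "[]"] fc_word_reduced[OF fc] by simp
  have "commutation_equivalent m u v" if v: "reduced v" "ev v = ev u" for v
  proof -
    have vJ: "v \<in> lists J" using reduced_parabolic_lists[OF J_subset v(1)] v u by simp
    have "commutation_equivalent m (t # u) (t # v)"
      using fc v reduced_Cons_t[OF v(1) vJ] by (simp add: fc_word_def)
    then have "commutation_equivalent m (filter (\<lambda>c. c \<noteq> t) (t # u)) (filter (\<lambda>c. c \<noteq> t) (t # v))"
      by (rule commutation_equivalent_filter)
    moreover have "filter (\<lambda>c. c \<noteq> t) x = x" if "x \<in> lists J" for x
      using that by (auto simp: filter_id_conv)
    ultimately show ?thesis using u vJ by simp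
  qed
  then show ?thesis using red by (simp add: fc_word_def)
qed

lemma fc_word_delete_t:
  assumes fc: "fc_word (p @ t # q)" and J: "p \<in> lists J" "q \<in> lists J" and c: "count_list (p @ q) s \<le> 1"
  shows "fc_word (p @ q)"
proof -
  have l: "p \<in> lists S" "q \<in> lists S" using J lists_J by auto
  have "s \<notin> set p \<or> s \<notin> set q"
    using c by (auto simp: count_list_0_iff[symmetric] simp del: count_list_0_iff)
  then show ?thesis
  proof
    assume "s \<notin> set p"
    then have "ev (t # p @ q) = ev (p @ t # q)"
      using commute_without_s[OF J(1)] l t by (simp flip: m_assoc)
    then have "fc_word (t # p @ q)"
      using fc_word_same_ev[OF fc] l t by simp
    then show ?thesis using fc_word_tl_t J by simp
  next
    assume "s \<notin> set q"
    then have "ev (p @ q @ [t]) = ev (p @ t # q)"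
      using commute_without_s[OF J(2)] l t by simp
    then have "fc_word (p @ q @ [t])"
      using fc_word_same_ev[OF fc] l t by simp
    from fc_word_rev[OF this] have "fc_word (t # rev (p @ q))" by simp
    moreover have "rev (p @ q) \<in> lists J" using J unfolding in_lists_conv_set by (simp add: ball_Un)
    ultimately have "fc_word (rev (p @ q))" by (rule fc_word_tl_t)
    from fc_word_rev[OF this] show ?thesis by simp
  qed
qed

section \<open>Multiplication by the last generator\<close>

text \<open>The hypothesis \<open>once\<close> is supplied for the six types by
  \<open>last_two_generators_once\<close>; the counting below uses nothing else about the type than
  this and the leaf \<open>t\<close>.\<close>

context
  assumes once: "\<And>u. \<lbrakk>reduced u; ev u \<in> CFC W S m\<rbrakk> \<Longrightarrow> count_list u s \<le> 1 \<and> count_list u t \<le> 1"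
begin

abbreviation C :: "'a set" where
  "C \<equiv> CFC W S m"

abbreviation CJ :: "'a set" where
  "CJ \<equiv> CFC W S m \<inter> ev ` lists J"

abbreviation CK :: "'a set" where
  "CK \<equiv> CFC W S m \<inter> ev ` lists K"

text \<open>A rotation of a reduced word of \<open>t w\<close> is a rotation of a reduced word of
  \<open>w\<close> with \<open>t\<close> inserted, and the insertion preserves FC because
  \<open>s\<close> occurs at most once.\<close>

lemma t_mult_CFC:
  assumes w: "w \<in> CJ"
  shows "t \<otimes> w \<in> C"
proof -
  have wc: "w \<in> carrier W" using w CFC_iff by blast
  have "fc_word (rotate k v)" if v: "reduced v" "ev v = t \<otimes> w" for v k
  proof -
    obtain a b where ab: "v = a @ t # b" "a \<in> lists J" "b \<in> lists J" "reduced (a @ b)" "ev (a @ b) = w"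
      using reduced_t_mult[of w v] w v by auto
    obtain p q j where pq: "rotate k v = p @ t # q" "p @ q = rotate j (a @ b)"
      using rotate_insert[of k a t b] ab by auto
    have "fc_word (rotate j (a @ b))" using ab w CFC_iff by blast
    then have "fc_word (p @ q)" using pq by simp
    moreover have "set (p @ q) = set (a @ b)" using pq by simp
    then have "p \<in> lists J" "q \<in> lists J" using ab by auto
    moreover have "count_list (p @ q) s \<le> 1"
      using once[of "a @ b"] ab w pq by simp
    ultimately show ?thesis using fc_word_insert_t pq(1) by simp
  qed
  then show ?thesis using CFC_iff wc t by simp
qed

text \<open>As \<open>a\<close> is free of \<open>s\<close>, the letter \<open>t\<close> moves to
  the front and leaves \<open>ab\<close>. For \<open>ab\<close> to be CFC, each rotation of a
  reduced word of it must be FC; it arises from a rotation of \<open>t v\<close> by deleting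
  \<open>t\<close>.\<close>

lemma CFC_t_split:
  assumes u: "reduced (a @ t # b)" "ev (a @ t # b) \<in> C" and a: "s \<notin> set a"
  shows "ev (a @ t # b) \<in> (\<lambda>w. t \<otimes> w) ` CJ"
proof -
  have c: "count_list (a @ t # b) s \<le> 1" "count_list (a @ t # b) t \<le> 1"
    using once[OF u] by auto
  have "t \<notin> set a" "t \<notin> set b"
    using c(2) by (auto simp: count_list_0_iff[symmetric] simp del: count_list_0_iff)
  then have J: "a \<in> lists J" "b \<in> lists J" using reduced_lists[OF u(1)] by auto
  then have l: "a \<in> lists S" "b \<in> lists S" using lists_J by auto
  have e: "ev (a @ t # b) = t \<otimes> ev (a @ b)"
    using commute_without_s[OF J(1) a] l t by (simp flip: m_assoc)
  have "reduced (t # a @ b)"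
    using reduced_if_length_le[OF u(1), of "t # a @ b"] e l t by simp
  then have rab: "reduced (a @ b)"
    using reduced_factor[of "[t]" "a @ b" "[]"] by simp
  have "fc_word (rotate k v)" if v: "reduced v" "ev v = ev (a @ b)" for v k
  proof -
    have vJ: "v \<in> lists J" using reduced_parabolic_lists[OF J_subset v(1)] v J by (simp del: ev_append)
    have tv: "reduced (t # v)" "ev (t # v) \<in> C"
      using reduced_Cons_t[OF v(1) vJ] u v e by simp_all
    then have fc: "fc_word (rotate j (t # v))" for j using CFC_iff by blast
    let ?x = "take (k mod length v) v" and ?y = "drop (k mod length v) v"
    \<comment> \<open>The \<open>k\<close>-th rotation of \<open>v\<close> is
      \<open>?y @ ?x\<close>; rotating \<open>t # v\<close> past \<open>t\<close> and
      \<open>?x\<close> gives the same word with \<open>t\<close> in between.\<close>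
    have "rotate (length (t # ?x)) ((t # ?x) @ ?y) = ?y @ t # ?x"
      by (rule rotate_append)
    then have "fc_word (?y @ t # ?x)" using fc[of "length (t # ?x)"] by simp
    moreover have "?x \<in> lists J" "?y \<in> lists J"
      using vJ by (auto dest: in_set_takeD in_set_dropD)
    moreover have "count_list (?y @ ?x) s = count_list (?x @ ?y) s"
      unfolding count_list_append by (rule add.commute)
    then have "count_list (?y @ ?x) s \<le> 1" using once[OF tv] s_neq_t by simp
    ultimately show ?thesis
      using fc_word_delete_t by (simp add: rotate_drop_take)
  qed
  then have "ev (a @ b) \<in> C" using CFC_iff ev_closed[of "a @ b"] l by (simp del: ev_append ev_closed)
  moreover have "ev (a @ b) \<in> ev ` lists J" using J by (intro imageI) simp
  ultimately show ?thesis using e by blast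
qed

lemma CFC_decomposition:
  "C = CJ \<union> ((\<lambda>w. t \<otimes> w) ` CJ \<union> (\<lambda>w. w \<otimes> t) ` CJ)"
proof (intro equalityI subsetI)
  fix w assume w: "w \<in> C"
  then have "w \<in> ev ` lists S" using CFC_iff carrier_eq_ev by blast
  then obtain u where u: "reduced u" "ev u = w" using reduced_exists by blast
  show "w \<in> CJ \<union> ((\<lambda>w. t \<otimes> w) ` CJ \<union> (\<lambda>w. w \<otimes> t) ` CJ)"
  proof (cases "t \<in> set u")
    case False
    then have "u \<in> lists J" using reduced_lists[OF u(1)] by auto
    then show ?thesis using u w by blast
  next
    case True
    then obtain a b where ab: "u = a @ t # b" by (meson split_list)
    have "count_list u s \<le> 1" using once u w by blast
    then have "count_list a s = 0 \<or> count_list b s = 0"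
      using ab s_neq_t by auto
    then consider "s \<notin> set a" | "s \<notin> set b"
      unfolding count_list_0_iff by blast
    then show ?thesis
    proof cases
      case 1
      then show ?thesis using CFC_t_split[of a b] u ab w by simp
    next
      case 2
      \<comment> \<open>Passing to the inverse puts the part free of \<open>s\<close> to the left of
        \<open>t\<close>.\<close>
      have r: "reduced (rev b @ t # rev a)" using reduced_rev[OF u(1)] ab by simp
      have e: "ev (rev b @ t # rev a) = inv w" using ev_rev[OF reduced_lists[OF u(1)]] ab u by simp
      have "inv w \<in> (\<lambda>w. t \<otimes> w) ` CJ"
        using CFC_t_split[OF r] 2 CFC_inv[OF w] e by simp
      then obtain x where x: "inv w = t \<otimes> x" "x \<in> CJ" by blast
      have "x \<in> carrier W" "w \<in> carrier W" using x w CFC_iff by auto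
      then have "w = inv x \<otimes> t" using x t by (metis generator_closed inv_generator inv_inv inv_mult_group)
      moreover have "inv x \<in> CJ" using x CFC_inv parabolic_inv[OF J_subset] by blast
      ultimately show ?thesis by blast
    qed
  qed
next
  fix w assume "w \<in> CJ \<union> ((\<lambda>w. t \<otimes> w) ` CJ \<union> (\<lambda>w. w \<otimes> t) ` CJ)"
  moreover have "x \<otimes> t \<in> C" if x: "x \<in> CJ" for x
  proof -
    have xc: "x \<in> carrier W" using x CFC_iff by blast
    have "inv x \<in> CJ" using x CFC_inv parabolic_inv[OF J_subset] by blast
    then have "inv (t \<otimes> inv x) \<in> C" using t_mult_CFC CFC_inv by blast
    then show ?thesis using xc t by (simp add: inv_mult_group)
  qed
  ultimately show "w \<in> C" using t_mult_CFC by blast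
qed

lemma t_mult_right_not_parabolic:
  assumes "w \<in> ev ` lists J"
  shows "w \<otimes> t \<notin> ev ` lists J"
proof
  assume "w \<otimes> t \<in> ev ` lists J"
  then have "inv (w \<otimes> t) \<in> ev ` lists J" by (rule parabolic_inv[OF J_subset])
  moreover have "w \<in> carrier W" using assms by (rule parabolic_closed)
  ultimately have "t \<otimes> inv w \<in> ev ` lists J" using t by (simp add: inv_mult_group)
  then show False using t_not_parabolic parabolic_inv[OF J_subset assms] by blast
qed

text \<open>\<open>t u\<close> and \<open>v t\<close> are reduced words of the same FC element, so
  their projections to \<open>{s, t}\<close> agree. The second ends in \<open>t\<close>, while the
  only \<open>t\<close> of the first is its first letter; hence \<open>u\<close> contains no
  \<open>s\<close>.\<close>

lemma left_right_intersection:
  "(\<lambda>w. t \<otimes> w) ` CJ \<inter> (\<lambda>w. w \<otimes> t) ` CJ = (\<lambda>w. t \<otimes> w) ` CK"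
proof (intro equalityI subsetI)
  fix g assume "g \<in> (\<lambda>w. t \<otimes> w) ` CJ \<inter> (\<lambda>w. w \<otimes> t) ` CJ"
  then obtain w x where wx: "g = t \<otimes> w" "w \<in> CJ" "g = x \<otimes> t" "x \<in> CJ" by blast
  have word: "\<exists>u. reduced u \<and> u \<in> lists J \<and> ev u = y" if y: "y \<in> ev ` lists J" for y
  proof -
    obtain x where x: "y = ev x" "x \<in> lists J" using y by (rule imageE)
    obtain u where "reduced u" "u \<in> lists J" "ev u = ev x"
      using parabolic_reduced_exists[OF J_subset x(2)] .
    then show ?thesis using x(1) by metis
  qed
  obtain u where u: "reduced u" "u \<in> lists J" "ev u = w" using word[OF IntD2[OF wx(2)]] by metis
  obtain v where v: "reduced v" "v \<in> lists J" "ev v = x" using word[OF IntD2[OF wx(4)]] by metis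
  have "reduced (t # u)" using reduced_Cons_t u by blast
  moreover have "ev (t # u) \<in> C" using t_mult_CFC wx u by simp
  ultimately have "fc_word (rotate 0 (t # u))" using CFC_iff by blast
  then have fc: "fc_word (t # u)" by simp
  have "reduced (rev (t # rev v))" using v reduced_rev by (intro reduced_rev reduced_Cons_t) auto
  then have "reduced (v @ [t])" by simp
  moreover have "ev (v @ [t]) = ev (t # u)" using u v wx t lists_J by simp
  ultimately have ce: "commutation_equivalent m (t # u) (v @ [t])" using fc by (simp add: fc_word_def)
  have "m s s \<noteq> 2" "m t t \<noteq> 2" "m s t \<noteq> 2" "m t s \<noteq> 2"
    using m_st m_self s t m_sym by (auto simp: one_enat_def numeral_eq_enat)
  then have f: "filter (\<lambda>c. c = s \<or> c = t) (t # u) = filter (\<lambda>c. c = s \<or> c = t) (v @ [t])"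
    using ce by (intro commutation_equivalent_filter_clique[of m]) auto
  have "s \<notin> set u"
  proof
    assume "s \<in> set u"
    then have ne: "filter (\<lambda>c. c = s \<or> c = t) u \<noteq> []" by (auto simp: filter_empty_conv)
    have "last (filter (\<lambda>c. c = s \<or> c = t) (t # u)) = t" unfolding f by simp
    then have "last (filter (\<lambda>c. c = s \<or> c = t) u) = t" using ne by simp
    then have "t \<in> set u" using last_in_set[OF ne] by simp
    then show False using u by auto
  qed
  then have "u \<in> lists K" using u by auto
  then have "ev u \<in> ev ` lists K" by (rule imageI)
  then have "w \<in> CK" using IntD1[OF wx(2)] u(3) by simp
  then show "g \<in> (\<lambda>w. t \<otimes> w) ` CK" using wx(1) by blast
next
  fix g assume "g \<in> (\<lambda>w. t \<otimes> w) ` CK"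
  then obtain u where u: "g = t \<otimes> ev u" "ev u \<in> C" "u \<in> lists K" by blast
  then have "u \<in> lists J" "s \<notin> set u" by auto
  then have "g = ev u \<otimes> t" "ev u \<in> CJ" using commute_without_s u by auto
  then show "g \<in> (\<lambda>w. t \<otimes> w) ` CJ \<inter> (\<lambda>w. w \<otimes> t) ` CJ" using u by blast
qed

text \<open>Both multiplications by \<open>t\<close> are injective and leave the subgroup of
  \<open>J\<close>, so \<open>C\<close> has \<open>card CJ + (2 * card CJ - card CK)\<close>
  elements, the overlap being a translate of \<open>CK\<close>.\<close>

lemma card_CFC:
  assumes "finite C"
  shows "int (card C) = 3 * int (card CJ) - int (card CK)"
proof -
  have f: "finite CJ" using assms by simp
  have closed: "w \<in> carrier W" if "w \<in> C" for w using that CFC_iff by blast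
  have "inj_on (\<lambda>w. t \<otimes> w) C" using closed t by (intro inj_onI) simp
  then have l: "card ((\<lambda>w. t \<otimes> w) ` CJ) = card CJ" "card ((\<lambda>w. t \<otimes> w) ` CK) = card CK"
    by (meson card_image inf_le1 inj_on_subset)+
  have "inj_on (\<lambda>w. w \<otimes> t) C" using closed t by (intro inj_onI) simp
  then have r: "card ((\<lambda>w. w \<otimes> t) ` CJ) = card CJ"
    by (meson card_image inf_le1 inj_on_subset)
  have "x \<notin> CJ" if x: "x \<in> (\<lambda>w. t \<otimes> w) ` CJ" for x
  proof -
    obtain w where "x = t \<otimes> w" "w \<in> CJ" using x by (rule imageE)
    then show ?thesis using t_not_parabolic[of w] by simp
  qed
  moreover have "x \<notin> CJ" if x: "x \<in> (\<lambda>w. w \<otimes> t) ` CJ" for x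
  proof -
    obtain w where "x = w \<otimes> t" "w \<in> CJ" using x by (rule imageE)
    then show ?thesis using t_mult_right_not_parabolic[of w] by simp
  qed
  ultimately have "CJ \<inter> ((\<lambda>w. t \<otimes> w) ` CJ \<union> (\<lambda>w. w \<otimes> t) ` CJ) = {}"
    by (intro equals0I) (metis IntE UnE)
  then have "card C = card CJ + card ((\<lambda>w. t \<otimes> w) ` CJ \<union> (\<lambda>w. w \<otimes> t) ` CJ)"
    using CFC_decomposition f card_Un_disjoint[of CJ] by (metis finite_UnI finite_imageI)
  moreover have "card CJ + card CJ = card ((\<lambda>w. t \<otimes> w) ` CJ \<union> (\<lambda>w. w \<otimes> t) ` CJ) + card CK"
    using card_Un_Int[of "(\<lambda>w. t \<otimes> w) ` CJ" "(\<lambda>w. w \<otimes> t) ` CJ"] f l r left_right_intersection by simp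
  ultimately show ?thesis by linarith
qed

end
end

section \<open>Gaps in cyclic words\<close>

text \<open>Adjacency in the numbering that is independent of the rank: the path continues without
  end, and 0 is joined to the branch vertex in every type. The actual vertices are singled out by
  \<open>x_le\<close> and \<open>x_zero\<close> below.\<close>

definition nb :: "cfc_type \<Rightarrow> nat \<Rightarrow> nat \<Rightarrow> bool" where
  "nb T a c \<longleftrightarrow> a \<noteq> c \<and> type_matrix T a c \<noteq> 2"

lemma type_matrix_sym: "type_matrix T i j = type_matrix T j i"
  by (simp add: type_matrix_def min.commute max.commute)

lemma nb_path: "branch_vertex T < i \<Longrightarrow> nb T i c \<Longrightarrow> c = i - 1 \<or> c = Suc i"
  by (cases T) (auto simp: nb_def type_matrix_def Let_def min_def max_def split: if_splits)

lemma type_matrix_path: "branch_vertex T \<le> i \<Longrightarrow> type_matrix T i (Suc i) = 3"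
  by (cases T) (auto simp: type_matrix_def path_label_def Let_def)

text \<open>
  \<open>x\<close> lists the vertices of an infinite repetition of a reduced word of length \<open>L\<close> of a CFC element.
  Each window of length \<open>L\<close> is a cyclic shift, hence a reduced FC word, so it contains no square
  and no long braid even after commutations; a configuration must fit into one window, which is
  what the bounds \<open>\<dots> < p + L\<close> say.
\<close>

locale cyclic_fc =
  fixes T :: cfc_type and N :: nat and x :: "nat \<Rightarrow> nat" and L :: nat
  assumes N: "branch_vertex T < N" "T = Type_H \<longrightarrow> 4 \<le> N"
    and x_le: "x i \<le> N"
    and x_zero: "x i = 0 \<Longrightarrow> T = Type_D \<or> T = Type_E"
    and periodic: "x (i + L) = x i"
    and no_square: "\<lbrakk>p < q; q < p + L; x p = a; x q = a\<rbrakk> \<Longrightarrow> \<exists>i. p < i \<and> i < q \<and> nb T a (x i)"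
    and no_braid3: "\<lbrakk>p < j; j < q; q < p + L; x p = a; x q = a; type_matrix T a (x j) = 3\<rbrakk> \<Longrightarrow>
      \<exists>i. p < i \<and> i < q \<and> i \<noteq> j \<and> nb T a (x i)"
    and no_braid4: "\<lbrakk>p0 < p1; p1 < p2; p2 < p3; p3 < p0 + L; x p0 = a; x p1 = b; x p2 = a; x p3 = b;
      type_matrix T a b = 4;
      \<And>i. \<lbrakk>p0 < i; i < p2; i \<noteq> p1\<rbrakk> \<Longrightarrow> type_matrix T a (x i) = 2;
      \<And>i. \<lbrakk>p1 < i; i < p3; i \<noteq> p2\<rbrakk> \<Longrightarrow> type_matrix T b (x i) = 2\<rbrakk> \<Longrightarrow> False"
    and no_braid5: "\<lbrakk>p0 < p1; p1 < p2; p2 < p3; p3 < p4; p4 < p0 + L;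
      x p0 = a; x p1 = b; x p2 = a; x p3 = b; x p4 = a; type_matrix T a b = 5;
      \<And>i. \<lbrakk>p0 < i; i < p2; i \<noteq> p1\<rbrakk> \<Longrightarrow> type_matrix T a (x i) = 2;
      \<And>i. \<lbrakk>p1 < i; i < p3; i \<noteq> p2\<rbrakk> \<Longrightarrow> type_matrix T b (x i) = 2;
      \<And>i. \<lbrakk>p2 < i; i < p4; i \<noteq> p3\<rbrakk> \<Longrightarrow> type_matrix T a (x i) = 2\<rbrakk> \<Longrightarrow> False"
begin

section \<open>Consecutive occurrences and their neighbours\<close>

lemma next_occurrence:
  assumes "p < q" "x q = a"
  obtains r where "p < r" "r \<le> q" "x r = a" "\<And>i. \<lbrakk>p < i; i < r\<rbrakk> \<Longrightarrow> x i \<noteq> a"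
proof -
  let ?r = "LEAST i. p < i \<and> x i = a"
  have "p < ?r \<and> x ?r = a" by (rule LeastI[of "\<lambda>i. p < i \<and> x i = a" q]) (use assms in simp)
  moreover have "?r \<le> q" by (rule Least_le) (use assms in simp)
  moreover have "x i \<noteq> a" if "p < i" "i < ?r" for i using not_less_Least[OF that(2)] that(1) by simp
  ultimately show ?thesis using that by blast
qed

lemma previous_occurrence:
  assumes "p < q" "x p = a"
  obtains r where "p \<le> r" "r < q" "x r = a" "\<And>i. \<lbrakk>r < i; i < q\<rbrakk> \<Longrightarrow> x i \<noteq> a"
proof -
  let ?r = "GREATEST i. i < q \<and> x i = a"
  have b: "i \<le> q" if "i < q \<and> x i = a" for i using that by simp
  have "?r < q \<and> x ?r = a" using GreatestI_nat[of "\<lambda>i. i < q \<and> x i = a" p q] b assms by simp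
  moreover have "p \<le> ?r" using Greatest_le_nat[of "\<lambda>i. i < q \<and> x i = a" p q] b assms by simp
  moreover have "x i \<noteq> a" if "?r < i" "i < q" for i
    using Greatest_le_nat[of "\<lambda>i. i < q \<and> x i = a" i q] b that by auto
  ultimately show ?thesis using that by blast
qed

text \<open>A first neighbour is forced by \<open>no_square\<close>. If it were the only one, its
  label 3 would produce the braid \<open>aba\<close>.\<close>

lemma two_neighbours:
  assumes "p < q" "q < p + L" "x p = a" "x q = a"
    and "\<And>i. \<lbrakk>p < i; i < q; nb T a (x i)\<rbrakk> \<Longrightarrow> type_matrix T a (x i) = 3"
  obtains i j where "p < i" "i < j" "j < q" "nb T a (x i)" "nb T a (x j)"
proof -
  obtain i where i: "p < i" "i < q" "nb T a (x i)" using no_square assms by blast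
  then obtain j where "p < j" "j < q" "j \<noteq> i" "nb T a (x j)"
    using no_braid3[OF i(1,2) assms(2-4)] assms(5) by blast
  then show ?thesis using that i by (metis nat_neq_iff)
qed

lemma nb_above_branch:
  assumes "branch_vertex T < i" "nb T i (x j)"
  shows "x j = i - 1 \<or> x j = Suc i"
  using assms nb_path by blast

lemma label_above_branch:
  assumes "branch_vertex T < i" "nb T i (x j)"
  shows "type_matrix T i (x j) = 3"
proof -
  have "type_matrix T (i - 1) i = 3" using assms(1) type_matrix_path[of T "i - 1"] by simp
  moreover have "type_matrix T i (Suc i) = 3" using assms(1) type_matrix_path by simp
  ultimately show ?thesis using nb_above_branch[OF assms] type_matrix_sym by metis
qed

text \<open>Downward induction from the end \<open>N\<close> of the path, whose only neighbour is
  \<open>N - 1\<close>. For smaller \<open>i\<close>, two neighbours lie between consecutive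
  occurrences; if both were \<open>Suc i\<close>, the induction hypothesis would put another
  \<open>i\<close> between them.\<close>

lemma left_neighbour_between:
  assumes "branch_vertex T < i" "i \<le> N" "p < q" "q < p + L" "x p = i" "x q = i"
  shows "\<exists>j. p < j \<and> j < q \<and> x j = i - 1"
  using assms(2,1,3-)
proof (induction i arbitrary: p q rule: inc_induct)
  case base
  then obtain j where "p < j" "j < q" "nb T N (x j)" using no_square by blast
  then show ?case using nb_above_branch[OF base(1)] x_le[of j] by force
next
  case (step i)
  obtain r where r: "p < r" "r \<le> q" "x r = i" "\<And>k. \<lbrakk>p < k; k < r\<rbrakk> \<Longrightarrow> x k \<noteq> i"
    using next_occurrence step.prems by metis
  then have rL: "r < p + L" using step.prems by simp
  obtain j k where jk: "p < j" "j < k" "k < r" "nb T i (x j)" "nb T i (x k)"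
    using two_neighbours[OF r(1) rL step.prems(4) r(3)] label_above_branch[OF step.prems(1)] by blast
  show ?case
  proof (rule ccontr)
    assume n: "\<not> ?thesis"
    have "x j = Suc i" "x k = Suc i"
      using jk n r nb_above_branch[OF step.prems(1)] by (meson less_trans less_le_trans)+
    moreover have "k < j + L" using jk rL by simp
    ultimately obtain l where "j < l" "l < k" "x l = i"
      using step.IH[of j k] jk step.prems(1) by auto
    then show False using r jk by simp
  qed
qed

text \<open>The configuration that is pushed down the branch: consecutive occurrences of
  \<open>i\<close> in one period that only vertices other than the right neighbour can keep
  apart.\<close>

definition inner_gap :: "nat \<Rightarrow> nat \<Rightarrow> nat \<Rightarrow> bool" where
  "inner_gap i p q \<longleftrightarrow> p < q \<and> q < p + L \<and> x p = i \<and> x q = i \<and>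
     (\<forall>j. p < j \<and> j < q \<longrightarrow> x j \<noteq> i \<and> x j \<noteq> Suc i)"

lemma inner_gap_of_pair:
  assumes "p < q" "q < p + L" "x p = i" "x q = i" "\<And>j. \<lbrakk>p < j; j < q\<rbrakk> \<Longrightarrow> x j \<noteq> Suc i"
  obtains r where "r \<le> q" "inner_gap i p r"
proof -
  obtain r where "p < r" "r \<le> q" "x r = i" "\<And>k. \<lbrakk>p < k; k < r\<rbrakk> \<Longrightarrow> x k \<noteq> i"
    using next_occurrence assms by metis
  then have "inner_gap i p r" unfolding inner_gap_def using assms by auto
  then show ?thesis using that \<open>r \<le> q\<close> by blast
qed

text \<open>The two neighbours found in the gap must both be \<open>i\<close>, as
  \<open>i + 2\<close> is excluded, and no \<open>Suc i\<close> lies between them.\<close>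

lemma inner_gap_step:
  assumes i: "branch_vertex T < Suc i" and g: "inner_gap (Suc i) p q"
  obtains u v where "p < u" "v < q" "inner_gap i u v"
proof -
  have pq: "p < q" "q < p + L" "x p = Suc i" "x q = Suc i"
    "\<And>j. \<lbrakk>p < j; j < q\<rbrakk> \<Longrightarrow> x j \<noteq> Suc i \<and> x j \<noteq> Suc (Suc i)"
    using g by (auto simp: inner_gap_def)
  obtain j k where jk: "p < j" "j < k" "k < q" "nb T (Suc i) (x j)" "nb T (Suc i) (x k)"
    using two_neighbours[OF pq(1-4)] label_above_branch[OF i] by blast
  then have "x j = i" "x k = i"
    using nb_above_branch[OF i] pq(5) by (metis diff_Suc_1 less_trans)+
  then obtain v where "v \<le> k" "inner_gap i j v"
    using inner_gap_of_pair[of j k i] jk pq by auto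
  then show ?thesis using that[of j v] jk by simp
qed

lemma inner_gap_descend:
  assumes "k \<le> i" "branch_vertex T \<le> k" "inner_gap i p q"
  shows "\<exists>u v. inner_gap k u v"
  using assms
proof (induction i arbitrary: p q rule: dec_induct)
  case (step i)
  then show ?case using inner_gap_step[of i p q] by (metis le_imp_less_Suc le_trans)
qed blast

lemma inner_gap_of_last:
  assumes "p < q" "q < p + L" "x p = N" "x q = N"
  shows "\<exists>u v. inner_gap (N - 1) u v"
proof -
  have "\<And>j. x j \<noteq> Suc N" using x_le by (metis not_less_eq_eq order_refl)
  then obtain r where "inner_gap N p r"
    using inner_gap_of_pair[OF assms] by blast
  then show ?thesis
    using inner_gap_step[of "N - 1" p r] N(1) by (metis Suc_diff_1 gr_implies_not_zero not_gr_zero)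
qed

text \<open>The two occurrences cut the period into two arcs. An arc without \<open>N\<close>
  contains an inner gap; if both contain \<open>N\<close>, then \<open>N\<close> occurs twice in a
  period and the previous lemma applies.\<close>

lemma inner_gap_of_penultimate:
  assumes "p < q" "q < p + L" "x p = N - 1" "x q = N - 1"
  shows "\<exists>u v. inner_gap (N - 1) u v"
proof -
  have SN: "Suc (N - 1) = N" using N by simp
  consider "\<And>j. \<lbrakk>p < j; j < q\<rbrakk> \<Longrightarrow> x j \<noteq> N" | "\<And>j. \<lbrakk>q < j; j < p + L\<rbrakk> \<Longrightarrow> x j \<noteq> N"
    | j k where "p < j" "j < q" "x j = N" "q < k" "k < p + L" "x k = N"
    by blast
  then show ?thesis
  proof cases
    case 1
    then show ?thesis using inner_gap_of_pair[OF assms] SN by metis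
  next
    case 2
    have "q < p + L" "p + L < q + L" "x q = N - 1" "x (p + L) = N - 1"
      using assms periodic by auto
    from inner_gap_of_pair[OF this] show ?thesis using 2 SN by metis
  next
    case 3
    then show ?thesis using inner_gap_of_last[of j k] by simp
  qed
qed

text \<open>Moves the gap away from position 0, so that the occurrence preceding it has a position
  too.\<close>

lemma inner_gap_shift: "inner_gap i p q \<Longrightarrow> inner_gap i (p + L) (q + L)"
proof -
  assume g: "inner_gap i p q"
  have "x j \<noteq> i \<and> x j \<noteq> Suc i" if "p + L < j" "j < q + L" for j
  proof -
    have "p < j - L" "j - L < q" "x (j - L) = x j"
      using that periodic[of "j - L"] by auto
    then show ?thesis using g unfolding inner_gap_def by metis
  qed
  then show ?thesis using g by (auto simp: inner_gap_def periodic)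
qed

text \<open>The occurrences of \<open>a\<close> directly before and after a gap. They need not be distinct modulo the period.\<close>

lemma adjacent_gaps:
  assumes "L \<le> p" "p < q" "q < p + L" "x p = a" "x q = a"
  obtains l r where "l < p" "q \<le> l + L" "x l = a" "\<And>i. \<lbrakk>l < i; i < p\<rbrakk> \<Longrightarrow> x i \<noteq> a"
    "q < r" "r \<le> p + L" "x r = a" "\<And>i. \<lbrakk>q < i; i < r\<rbrakk> \<Longrightarrow> x i \<noteq> a"
proof -
  have "x (q - L) = a" "q - L < p" using periodic[of "q - L"] assms by auto
  from previous_occurrence[OF this(2,1)] obtain l where
    l: "q - L \<le> l" "l < p" "x l = a" "\<And>i. \<lbrakk>l < i; i < p\<rbrakk> \<Longrightarrow> x i \<noteq> a" by blast
  have "x (p + L) = a" using periodic assms by simp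
  from next_occurrence[OF assms(3) this] obtain r where
    "q < r" "r \<le> p + L" "x r = a" "\<And>i. \<lbrakk>q < i; i < r\<rbrakk> \<Longrightarrow> x i \<noteq> a" by blast
  then show ?thesis using that[of l r] l by simp
qed

lemma between_twice_right:
  assumes "branch_vertex T \<le> k" "k < N" "p < q" "q < p + L" "x p = Suc k" "x q = Suc k"
  shows "\<exists>j. p < j \<and> j < q \<and> x j = k"
  using left_neighbour_between[of "Suc k" p q] assms by simp

lemma inner_gap_context:
  assumes "inner_gap k u v"
  obtains l p q r where "inner_gap k p q" "l < p" "q \<le> l + L" "x l = k" "\<And>i. \<lbrakk>l < i; i < p\<rbrakk> \<Longrightarrow> x i \<noteq> k"
    "q < r" "r \<le> p + L" "x r = k" "\<And>i. \<lbrakk>q < i; i < r\<rbrakk> \<Longrightarrow> x i \<noteq> k"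
proof -
  have g: "inner_gap k (u + L) (v + L)" using assms by (rule inner_gap_shift)
  then have "L \<le> u + L" "u + L < v + L" "v + L < u + L + L" "x (u + L) = k" "x (v + L) = k"
    by (auto simp: inner_gap_def)
  from adjacent_gaps[OF this] show ?thesis using that[OF g] by blast
qed

text \<open>Used through \<open>separates_unique\<close>: an arc free of \<open>c\<close> and no
  longer than a period contains \<open>d\<close> at most once.\<close>

definition separates :: "nat \<Rightarrow> nat \<Rightarrow> bool" where
  "separates c d \<longleftrightarrow> (\<forall>p q. p < q \<and> q < p + L \<and> x p = d \<and> x q = d \<longrightarrow> (\<exists>i. p < i \<and> i < q \<and> x i = c))"

lemma separates_right: "\<lbrakk>branch_vertex T \<le> k; k < N\<rbrakk> \<Longrightarrow> separates k (Suc k)"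
  unfolding separates_def using between_twice_right by blast

lemma separates_leaf: "(\<And>i. nb T d (x i) \<Longrightarrow> x i = c) \<Longrightarrow> separates c d"
  unfolding separates_def using no_square by metis

lemma separates_unique:
  assumes s: "separates c d" and n: "\<And>i. \<lbrakk>p < i; i < q\<rbrakk> \<Longrightarrow> x i \<noteq> c" and q: "q \<le> p + L"
    and "p < i" "i < q" "x i = d" "p < j" "j < q" "x j = d"
  shows "i = j"
proof -
  have False if ij: "p < i" "i < j" "j < q" "x i = d" "x j = d" for i j
  proof -
    have "j < i + L" using ij q by simp
    then have "\<exists>k. i < k \<and> k < j \<and> x k = c"
      using s ij(2,4,5) by (simp add: separates_def)
    then obtain k where "i < k" "k < j" "x k = c" by blast
    then show False using n[of k] ij by simp
  qed
  then show ?thesis using assms by (metis nat_neq_iff)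
qed

section \<open>Excluding inner gaps type by type\<close>

lemma no_inner_gap_A:
  assumes T: "T = Type_A"
  shows "\<not> inner_gap 1 u v"
proof
  assume "inner_gap 1 u v"
  \<comment> \<open>The gap needs a neighbour of 1 other than 2, and the path has none.\<close>
  then obtain i where i: "nb T 1 (x i)" "x i \<noteq> Suc 1"
    using no_square[of u v 1] unfolding inner_gap_def by metis
  have "x i \<noteq> 0" using x_zero T by fastforce
  then show False using i T
    by (auto simp: nb_def type_matrix_def Let_def min_def max_def split: if_splits)
qed

text \<open>The inner gap contains exactly one 1, and the following gap contains a 1 as well, which
  completes the braid \<open>2 1 2 1\<close> of label 4.\<close>

lemma no_inner_gap_B:
  assumes T: "T = Type_B"
  shows "\<not> inner_gap 2 u v"
proof
  assume inner: "inner_gap 2 u v"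
  obtain l p q r where g: "inner_gap 2 p q" "l < p" "q \<le> l + L" "x l = 2" "\<And>i. \<lbrakk>l < i; i < p\<rbrakk> \<Longrightarrow> x i \<noteq> 2"
    "q < r" "r \<le> p + L" "x r = 2" "\<And>i. \<lbrakk>q < i; i < r\<rbrakk> \<Longrightarrow> x i \<noteq> 2"
    by (rule inner_gap_context[OF inner]) (rule that)
  then have pq: "p < q" "q < p + L" "x p = 2" "x q = 2" and
    n2: "\<And>j. \<lbrakk>p < j; j < q\<rbrakk> \<Longrightarrow> x j \<noteq> 2" and n3: "\<And>j. \<lbrakk>p < j; j < q\<rbrakk> \<Longrightarrow> x j \<noteq> 3"
    by (auto simp: inner_gap_def numeral_3_eq_3 numeral_2_eq_2)
  have nz: "x i \<noteq> 0" for i using x_zero T by fastforce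
  have nb2: "x i = 1 \<or> x i = 3" if "nb T 2 (x i)" for i
    using that T nz[of i] by (auto simp: nb_def type_matrix_def Let_def min_def max_def split: if_splits)
  have nb1: "x i = 2" if "nb T 1 (x i)" for i
    using that T nz[of i] by (auto simp: nb_def type_matrix_def Let_def min_def max_def split: if_splits)
  have labels: "type_matrix T 2 1 = 4" "type_matrix T 2 3 = 3"
    using T by (simp_all add: type_matrix_def path_label_def Let_def)
  have s1: "separates 2 1" using nb1 by (rule separates_leaf)
  have s3: "separates 2 3" using separates_right[of 2] N T by simp
  have le: "q \<le> p + L" "r \<le> q + L" "r < q + L" using pq g by auto
  obtain j where j: "p < j" "j < q" "x j = 1"
    using no_square[OF pq] nb2 n3 by metis
  note unique_j = separates_unique[OF s1 n2 le(1) _ _ _ j]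
  \<comment> \<open>Without a 1 the gap would contain only the neighbour 3, and that once, leaving
    the braid \<open>2 3 2\<close>.\<close>
  obtain k where k: "q < k" "k < r" "x k = 1"
  proof -
    obtain i where i: "q < i" "i < r" "nb T 2 (x i)"
      using no_square[OF g(6) le(3) pq(4) g(8)] by blast
    show ?thesis
    proof (cases "x i = 1")
      case False
      then have x3: "x i = 3" using nb2 i by blast
      then obtain i' where i': "q < i'" "i' < r" "i' \<noteq> i" "nb T 2 (x i')"
        using no_braid3[OF i(1,2) le(3) pq(4) g(8)] labels by auto
      have "x i' \<noteq> 3"
        using separates_unique[OF s3 g(9) le(2) i'(1,2) _ i(1,2) x3] i'(3) by blast
      then show ?thesis using nb2 i' that by blast
    qed (use that i in blast)
  qed
  note unique_k = separates_unique[OF s1 g(9) le(2) _ _ _ k]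
  have c2: "type_matrix T 2 (x i) = 2" if "p < i" "i < q" "i \<noteq> j" for i
    using that unique_j[of i] nb2[of i] n2[of i] n3[of i] by (auto simp: nb_def)
  have c1: "type_matrix T 1 (x i) = 2" if i: "j < i" "i < k" "i \<noteq> q" for i
  proof -
    have "x i \<noteq> 2" using n2[of i] g(9)[of i] i j k by (cases "i < q") auto
    moreover have "x i \<noteq> 1"
      using unique_j[of i] unique_k[of i] i j k by (cases "i < q") auto
    ultimately show ?thesis using nb1[of i] by (auto simp: nb_def)
  qed
  have "k < p + L" using k g by simp
  from no_braid4[OF j(1,2) k(1) this pq(3) j(3) pq(4) k(3) labels(1) c2 c1]
  show False by blast
qed

text \<open>The inner gap contains each of the leaves 0 and 1, so the next gap contains neither,
  since \<open>0 2 0\<close> and \<open>1 2 1\<close> are braids. It would need two occurrences of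
  3, but these are separated by 2.\<close>

lemma no_inner_gap_D:
  assumes T: "T = Type_D"
  shows "\<not> inner_gap 2 u v"
proof
  assume inner: "inner_gap 2 u v"
  obtain l p q r where g: "inner_gap 2 p q" "l < p" "q \<le> l + L" "x l = 2" "\<And>i. \<lbrakk>l < i; i < p\<rbrakk> \<Longrightarrow> x i \<noteq> 2"
    "q < r" "r \<le> p + L" "x r = 2" "\<And>i. \<lbrakk>q < i; i < r\<rbrakk> \<Longrightarrow> x i \<noteq> 2"
    by (rule inner_gap_context[OF inner]) (rule that)
  then have pq: "p < q" "q < p + L" "x p = 2" "x q = 2" and
    n2: "\<And>j. \<lbrakk>p < j; j < q\<rbrakk> \<Longrightarrow> x j \<noteq> 2" and n3: "\<And>j. \<lbrakk>p < j; j < q\<rbrakk> \<Longrightarrow> x j \<noteq> 3"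
    by (auto simp: inner_gap_def numeral_3_eq_3 numeral_2_eq_2)
  have nb2: "x i = 0 \<or> x i = 1 \<or> x i = 3" if "nb T 2 (x i)" for i
    using that T by (auto simp: nb_def type_matrix_def Let_def min_def max_def split: if_splits)
  have nb01: "x i = 2" if "nb T d (x i)" "d = 0 \<or> d = 1" for i d
    using that T by (auto simp: nb_def type_matrix_def Let_def min_def max_def split: if_splits)
  have labels: "type_matrix T 2 3 = 3" "\<And>d. d = 0 \<or> d = 1 \<Longrightarrow> type_matrix T d 2 = 3"
    using T by (auto simp: type_matrix_def path_label_def Let_def)
  have label: "type_matrix T 2 (x i) = 3" if "nb T 2 (x i)" for i
    using nb2[OF that] labels type_matrix_sym[of T 2] by metis
  have s01: "separates 2 d" if "d = 0 \<or> d = 1" for d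
    using nb01 that by (intro separates_leaf) blast
  have s3: "separates 2 3" using separates_right[of 2] N T by simp
  have le: "q \<le> p + L" "r \<le> q + L" "r < q + L" using pq g by auto
  obtain i j where ij: "p < i" "i < j" "j < q" "nb T 2 (x i)" "nb T 2 (x j)"
    using two_neighbours[OF pq] label by blast
  have *: "x i = 0 \<or> x i = 1" "x j = 0 \<or> x j = 1"
    using nb2 ij n3 by (meson less_trans)+
  have "x i \<noteq> x j"
    using separates_unique[OF s01[OF *(1)] n2 le(1), of i j] ij by auto
  then have d: "\<exists>k. p < k \<and> k < q \<and> x k = d" if "d = 0 \<or> d = 1" for d
    using * that ij by (metis less_trans)
  have n01: "x k \<noteq> d" if k: "q < k" "k < r" and dd: "d = 0 \<or> d = 1" for k d
  proof
    assume xk: "x k = d"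
    obtain j where j: "p < j" "j < q" "x j = d" using d[OF dd] by blast
    have "k < j + L" using k g j by simp
    then obtain i where i: "j < i" "i < k" "i \<noteq> q" "nb T d (x i)"
      using no_braid3[OF j(2) k(1) _ j(3) xk] labels(2)[OF dd] pq(4) by auto
    then have "x i = 2" using nb01 dd by blast
    then show False using n2[of i] g(9)[of i] i j k by (cases "i < q") auto
  qed
  obtain i j where ij: "q < i" "i < j" "j < r" "nb T 2 (x i)" "nb T 2 (x j)"
    using two_neighbours[OF g(6) le(3) pq(4) g(8)] label by blast
  have "x i = 3" using nb2[OF ij(4)] n01[of i] ij by auto
  moreover have "x j = 3" using nb2[OF ij(5)] n01[of j] ij by auto
  ultimately show False
    using separates_unique[OF s3 g(9) le(2), of i j] ij by auto
qed

text \<open>Three successive gaps of 3 contain a 2 each, at \<open>i\<close>, \<open>j\<close> and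
  \<open>k\<close>. The 1s at \<open>y\<close> and \<open>z\<close> then have only the 2 at
  \<open>j\<close> between them, which is the braid \<open>1 2 1\<close>.\<close>

lemma no_inner_gap_EF_aux:
  assumes T: "T = Type_E \<or> T = Type_F"
    and lr: "q \<le> l + L" "r \<le> p + L"
      "\<And>i. \<lbrakk>l < i; i < p\<rbrakk> \<Longrightarrow> x i \<noteq> 3" "\<And>i. \<lbrakk>p < i; i < q\<rbrakk> \<Longrightarrow> x i \<noteq> 3" "\<And>i. \<lbrakk>q < i; i < r\<rbrakk> \<Longrightarrow> x i \<noteq> 3"
      "x p = 3" "x q = 3"
    and ijk: "l < i" "i < p" "p < j" "j < q" "q < k" "k < r" "x i = 2" "x j = 2" "x k = 2"
    and yz: "i < y" "y < j" "x y = 1" "j < z" "z < k" "x z = 1"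
    and s2: "separates 3 2"
  shows False
proof -
  have nb1: "x i = 2" if "nb T 1 (x i)" for i
    using that T x_zero[of i] by (auto simp: nb_def type_matrix_def Let_def min_def max_def split: if_splits)
  have label: "type_matrix T 1 2 = 3"
    using T by (auto simp: type_matrix_def path_label_def Let_def)
  have le: "p \<le> l + L" "q \<le> p + L" "r \<le> q + L" using lr ijk by auto
  \<comment> \<open>Otherwise the last gap would contain two occurrences of 2, at
    \<open>i + L\<close> and at \<open>k\<close>.\<close>
  have "k \<le> i + L"
  proof (rule ccontr)
    assume "\<not> k \<le> i + L"
    then show False
      using separates_unique[OF s2 lr(5) le(3), of "i + L" k] periodic ijk lr by auto
  qed
  then have "z < y + L" using yz by simp
  then obtain w where w: "y < w" "w < z" "w \<noteq> j" "nb T 1 (x w)"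
    using no_braid3[OF yz(2,4) _ yz(3,6)] label ijk by auto
  have "x w = 2" using nb1 w by blast
  moreover from this have "w \<noteq> p" "w \<noteq> q" using lr by auto
  then consider "w < p" | "p < w" "w < q" | "q < w" by linarith
  ultimately show False
    using separates_unique[OF s2 lr(3) le(1), of w i] separates_unique[OF s2 lr(4) le(2), of w j]
      separates_unique[OF s2 lr(5) le(3), of w k] w yz ijk by cases auto
qed

text \<open>Without a 3, two consecutive 2s would need two 1s between them, but the leaf 1 cannot
  recur without a 2.\<close>

lemma separates_EF:
  assumes T: "T = Type_E \<or> T = Type_F"
  shows "separates 3 2"
  unfolding separates_def
proof (intro allI impI)
  fix p q assume pq: "p < q \<and> q < p + L \<and> x p = 2 \<and> x q = 2"
  have nz: "nb T 1 (x i) \<Longrightarrow> x i = 2" for i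
    using T x_zero[of i] by (auto simp: nb_def type_matrix_def Let_def min_def max_def split: if_splits)
  then have s1: "separates 2 1" by (rule separates_leaf)
  have nb2: "x i = 1 \<or> x i = 3" if "nb T 2 (x i)" for i
    using that T x_zero[of i] by (auto simp: nb_def type_matrix_def Let_def min_def max_def split: if_splits)
  have label: "type_matrix T 2 1 = 3"
    using T by (auto simp: type_matrix_def path_label_def Let_def)
  obtain r where r: "p < r" "r \<le> q" "x r = 2" and n2: "\<And>k. \<lbrakk>p < k; k < r\<rbrakk> \<Longrightarrow> x k \<noteq> 2"
    using next_occurrence pq by metis
  show "\<exists>i. p < i \<and> i < q \<and> x i = 3"
  proof (rule ccontr)
    assume n: "\<not> ?thesis"
    have one: "x i = 1" if "p < i" "i < r" "nb T 2 (x i)" for i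
      using nb2 that n r by (meson less_le_trans)
    have rL: "r < p + L" "r \<le> p + L" and xp: "x p = 2" using pq r by auto
    obtain i j where ij: "p < i" "i < j" "j < r" "nb T 2 (x i)" "nb T 2 (x j)"
      using two_neighbours[OF r(1) rL(1) xp r(3)] one label by metis
    then show False
      using separates_unique[OF s1 n2 rL(2), of i j] one[of i] one[of j] by auto
  qed
qed

text \<open>The inner gap contains 0 and 2 once each. The gaps on both sides cannot contain 0,
  because of the braid \<open>0 3 0\<close>, and contain 4 at most once, so each has a 2. Avoiding
  \<open>2 3 2\<close> on either side forces the 1s required by
  \<open>no_inner_gap_EF_aux\<close>.\<close>

lemma no_inner_gap_E:
  assumes T: "T = Type_E"
  shows "\<not> inner_gap 3 u v"
proof
  assume inner: "inner_gap 3 u v"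
  obtain l p q r where g: "inner_gap 3 p q" "l < p" "q \<le> l + L" "x l = 3" "\<And>i. \<lbrakk>l < i; i < p\<rbrakk> \<Longrightarrow> x i \<noteq> 3"
    "q < r" "r \<le> p + L" "x r = 3" "\<And>i. \<lbrakk>q < i; i < r\<rbrakk> \<Longrightarrow> x i \<noteq> 3"
    by (rule inner_gap_context[OF inner]) (rule that)
  then have pq: "p < q" "q < p + L" "x p = 3" "x q = 3" and
    n3: "\<And>j. \<lbrakk>p < j; j < q\<rbrakk> \<Longrightarrow> x j \<noteq> 3" and n4: "\<And>j. \<lbrakk>p < j; j < q\<rbrakk> \<Longrightarrow> x j \<noteq> 4"
    by (auto simp: inner_gap_def eval_nat_numeral)
  have nb3: "x i = 0 \<or> x i = 2 \<or> x i = 4" if "nb T 3 (x i)" for i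
    using that T by (auto simp: nb_def type_matrix_def Let_def min_def max_def split: if_splits)
  have nb2: "x i = 1 \<or> x i = 3" if "nb T 2 (x i)" for i
    using that T by (auto simp: nb_def type_matrix_def Let_def min_def max_def split: if_splits)
  have nb0: "x i = 3" if "nb T 0 (x i)" for i
    using that T by (auto simp: nb_def type_matrix_def Let_def min_def max_def split: if_splits)
  have labels: "type_matrix T 3 4 = 3" "type_matrix T 3 2 = 3" "type_matrix T 2 3 = 3"
      "type_matrix T 3 0 = 3" "type_matrix T 0 3 = 3"
    using T by (auto simp: type_matrix_def path_label_def Let_def)
  have label: "type_matrix T 3 (x i) = 3" if "nb T 3 (x i)" for i
    using nb3[OF that] labels by metis
  have s0: "separates 3 0" using nb0 by (rule separates_leaf)
  have s2: "separates 3 2" using separates_EF T by simp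
  have s4: "separates 3 4" using separates_right[of 3] N T by simp
  have le: "q \<le> p + L" "r \<le> q + L" "r < q + L" "p \<le> l + L" "p < l + L" using pq g by auto
  obtain i j where ij: "p < i" "i < j" "j < q" "nb T 3 (x i)" "nb T 3 (x j)"
    using two_neighbours[OF pq] label by blast
  have *: "x i = 0 \<or> x i = 2" "x j = 0 \<or> x j = 2"
    using nb3[OF ij(4)] nb3[OF ij(5)] n4[of i] n4[of j] ij by auto
  have "x i \<noteq> x j"
    using separates_unique[OF s0 n3 le(1), of i j] separates_unique[OF s2 n3 le(1), of i j] ij * by auto
  then have d: "\<exists>k. p < k \<and> k < q \<and> x k = d" if "d = 0 \<or> d = 2" for d
    using * that ij by (metis less_trans)
  obtain j0 where j0: "p < j0" "j0 < q" "x j0 = 0" using d by blast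
  obtain j2 where j2: "p < j2" "j2 < q" "x j2 = 2" using d by blast
  have r0: "x k \<noteq> 0" if k: "q < k" "k < r" for k
  proof
    assume xk: "x k = 0"
    have "k < j0 + L" using k g j0 by simp
    then obtain w where w: "j0 < w" "w < k" "w \<noteq> q" "nb T 0 (x w)"
      using no_braid3[OF j0(2) k(1) _ j0(3) xk] labels pq(4) by auto
    then have "x w = 3" using nb0 by blast
    then show False using n3[of w] g(9)[of w] w j0 k by (cases "w < q") auto
  qed
  have l0: "x k \<noteq> 0" if k: "l < k" "k < p" for k
  proof
    assume xk: "x k = 0"
    have "j0 < k + L" using k g j0 by simp
    then obtain w where w: "k < w" "w < j0" "w \<noteq> p" "nb T 0 (x w)"
      using no_braid3[OF k(2) j0(1) _ xk j0(3)] labels pq(3) by auto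
    then have "x w = 3" using nb0 by blast
    then show False using n3[of w] g(5)[of w] w j0 k by (cases "w < p") auto
  qed
  obtain k where k: "q < k" "k < r" "x k = 2"
  proof -
    obtain i j where ij: "q < i" "i < j" "j < r" "nb T 3 (x i)" "nb T 3 (x j)"
      using two_neighbours[OF g(6) le(3) pq(4) g(8)] label by blast
    then have "x i \<noteq> 4 \<or> x j \<noteq> 4"
      using separates_unique[OF s4 g(9) le(2), of i j] by auto
    then have "x i = 2 \<or> x j = 2" using nb3[OF ij(4)] nb3[OF ij(5)] r0[of i] r0[of j] ij by auto
    then show ?thesis using ij that by (metis less_trans)
  qed
  obtain i where i: "l < i" "i < p" "x i = 2"
  proof -
    obtain i j where ij: "l < i" "i < j" "j < p" "nb T 3 (x i)" "nb T 3 (x j)"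
      using two_neighbours[OF g(2) le(5) g(4) pq(3)] label by blast
    then have "x i \<noteq> 4 \<or> x j \<noteq> 4"
      using separates_unique[OF s4 g(5) le(4), of i j] by auto
    then have "x i = 2 \<or> x j = 2" using nb3[OF ij(4)] nb3[OF ij(5)] l0[of i] l0[of j] ij by auto
    then show ?thesis using ij that by (metis less_trans)
  qed
  obtain y where y: "i < y" "y < j2" "x y = 1"
  proof -
    have "j2 < i + L" using i j2 g by simp
    then obtain w where w: "i < w" "w < j2" "w \<noteq> p" "nb T 2 (x w)"
      using no_braid3[OF i(2) j2(1) _ i(3) j2(3)] labels pq(3) by auto
    then have "x w \<noteq> 3" using n3[of w] g(5)[of w] i j2 by (cases "w < p") auto
    then show ?thesis using that nb2 w by blast
  qed
  obtain z where z: "j2 < z" "z < k" "x z = 1"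
  proof -
    have "k < j2 + L" using k j2 g by simp
    then obtain w where w: "j2 < w" "w < k" "w \<noteq> q" "nb T 2 (x w)"
      using no_braid3[OF j2(2) k(1) _ j2(3) k(3)] labels pq(4) by auto
    then have "x w \<noteq> 3" using n3[of w] g(9)[of w] k j2 by (cases "w < q") auto
    then show ?thesis using that nb2 w by blast
  qed
  show False
    using no_inner_gap_EF_aux[OF _ g(3,7,5) n3 g(9) pq(3,4) i(1,2) j2(1,2) k(1,2) i(3) j2(3) k(3) y z s2] T
    by blast
qed

text \<open>Every gap of 3 contains a 2, since a lone 4 would give \<open>3 4 3\<close>. In the
  inner gap this 2 is the only neighbour of 3, so avoiding the braids \<open>2 3 2 3\<close> and
  \<open>3 2 3 2\<close> of label 4 forces a 1 on either side of it.\<close>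

lemma no_inner_gap_F:
  assumes T: "T = Type_F"
  shows "\<not> inner_gap 3 u v"
proof
  assume inner: "inner_gap 3 u v"
  obtain l p q r where g: "inner_gap 3 p q" "l < p" "q \<le> l + L" "x l = 3" "\<And>i. \<lbrakk>l < i; i < p\<rbrakk> \<Longrightarrow> x i \<noteq> 3"
    "q < r" "r \<le> p + L" "x r = 3" "\<And>i. \<lbrakk>q < i; i < r\<rbrakk> \<Longrightarrow> x i \<noteq> 3"
    by (rule inner_gap_context[OF inner]) (rule that)
  then have pq: "p < q" "q < p + L" "x p = 3" "x q = 3" and
    n3: "\<And>j. \<lbrakk>p < j; j < q\<rbrakk> \<Longrightarrow> x j \<noteq> 3" and n4: "\<And>j. \<lbrakk>p < j; j < q\<rbrakk> \<Longrightarrow> x j \<noteq> 4"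
    by (auto simp: inner_gap_def eval_nat_numeral)
  have nz: "x i \<noteq> 0" for i using x_zero T by fastforce
  have nb3: "x i = 2 \<or> x i = 4" if "nb T 3 (x i)" for i
    using that T nz[of i] by (auto simp: nb_def type_matrix_def Let_def min_def max_def split: if_splits)
  have nb2: "x i = 1 \<or> x i = 3" if "nb T 2 (x i)" for i
    using that T nz[of i] by (auto simp: nb_def type_matrix_def Let_def min_def max_def split: if_splits)
  have labels: "type_matrix T 3 4 = 3" "type_matrix T 3 2 = 4" "type_matrix T 2 3 = 4"
    using T by (auto simp: type_matrix_def path_label_def Let_def)
  have s2: "separates 3 2" using separates_EF T by simp
  have s4: "separates 3 4" using separates_right[of 3] N T by simp
  have le: "q \<le> p + L" "r \<le> q + L" "r < q + L" "p \<le> l + L" "p < l + L" using pq g by auto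
  have two: "\<exists>w. a < w \<and> w < b \<and> x w = 2"
    if ab: "a < b" "b < a + L" "x a = 3" "x b = 3" and n: "\<And>w. \<lbrakk>a < w; w < b\<rbrakk> \<Longrightarrow> x w \<noteq> 3" for a b
  proof (rule ccontr)
    assume no: "\<not> ?thesis"
    obtain w where w: "a < w" "w < b" "nb T 3 (x w)" using no_square[OF ab] by blast
    have x4: "x w = 4" using nb3[OF w(3)] no w by blast
    obtain w' where w': "a < w'" "w' < b" "w' \<noteq> w" "nb T 3 (x w')"
      using no_braid3[OF w(1,2) ab(2-)] x4 labels by auto
    have x4': "x w' = 4" using nb3[OF w'(4)] no w' by blast
    have "b \<le> a + L" using ab by simp
    from separates_unique[OF s4 n this w(1,2) x4 w'(1,2) x4'] w' show False by simp
  qed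
  obtain j where j: "p < j" "j < q" "x j = 2" using two[OF pq n3] by blast
  obtain k where k: "q < k" "k < r" "x k = 2" using two[OF g(6) le(3) pq(4) g(8,9)] by blast
  obtain i where i: "l < i" "i < p" "x i = 2" using two[OF g(2) le(5) g(4) pq(3) g(5)] by blast
  note unique_i = separates_unique[OF s2 g(5) le(4) _ _ _ i]
    and unique_j = separates_unique[OF s2 n3 le(1) _ _ _ j]
    and unique_k = separates_unique[OF s2 g(9) le(2) _ _ _ k]
  have c3: "type_matrix T 3 (x w) = 2" if "p < w" "w < q" "w \<noteq> j" for w
    using that unique_j[of w] nb3[of w] n3[of w] n4[of w] by (auto simp: nb_def)
  obtain y where y: "i < y" "y < j" "x y = 1"
  proof (rule ccontr)
    assume "\<not> thesis"
    then have n1: "x w \<noteq> 1" if "i < w" "w < j" for w using that \<open>\<And>y. \<lbrakk>i < y; y < j; x y = 1\<rbrakk> \<Longrightarrow> thesis\<close> by blast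
    have "type_matrix T 2 (x w) = 2" if w: "i < w" "w < j" "w \<noteq> p" for w
    proof -
      have "x w \<noteq> 3" using n3[of w] g(5)[of w] i j w by (cases "w < p") auto
      moreover have "x w \<noteq> 2" using unique_i[of w] unique_j[of w] i j w by (cases "w < p") auto
      ultimately show ?thesis using nb2[of w] n1[of w] w by (auto simp: nb_def)
    qed
    moreover have "q < i + L" using i g by simp
    ultimately show False
      using no_braid4[OF i(2) j(1,2) _ i(3) pq(3) j(3) pq(4) labels(3)] c3 by blast
  qed
  obtain z where z: "j < z" "z < k" "x z = 1"
  proof (rule ccontr)
    assume "\<not> thesis"
    then have n1: "x w \<noteq> 1" if "j < w" "w < k" for w using that \<open>\<And>y. \<lbrakk>j < y; y < k; x y = 1\<rbrakk> \<Longrightarrow> thesis\<close> by blast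
    have "type_matrix T 2 (x w) = 2" if w: "j < w" "w < k" "w \<noteq> q" for w
    proof -
      have "x w \<noteq> 3" using n3[of w] g(9)[of w] k j w by (cases "w < q") auto
      moreover have "x w \<noteq> 2" using unique_k[of w] unique_j[of w] k j w by (cases "w < q") auto
      ultimately show ?thesis using nb2[of w] n1[of w] w by (auto simp: nb_def)
    qed
    moreover have "k < p + L" using k g by simp
    ultimately show False
      using no_braid4[OF j(1,2) k(1) _ pq(3) j(3) pq(4) k(3) labels(2)] c3 by blast
  qed
  show False
    using no_inner_gap_EF_aux[OF _ g(3,7,5) n3 g(9) pq(3,4) i(1,2) j(1,2) k(1,2) i(3) j(3) k(3) y z s2] T
    by blast
qed

text \<open>
  In type \<open>H\<close> an inner gap of the branch vertex \<open>2\<close> can occur (\<open>v\<^sub>1v\<^sub>2v\<^sub>1v\<^sub>2v\<^sub>3\<close> is CFC in \<open>H\<^sub>3\<close>),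
  so the contradiction has to be found one vertex further right.
\<close>

lemma no_inner_gap_H:
  assumes T: "T = Type_H"
  shows "\<not> inner_gap 3 u v"
proof
  assume "inner_gap 3 u v"
  then have "inner_gap 3 (u + L) (v + L)" by (rule inner_gap_shift)
  then obtain p' q' where g': "L \<le> p'" "p' < q'" "q' < p' + L" "x p' = 3" "x q' = 3" and
    n3: "\<And>j. \<lbrakk>p' < j; j < q'\<rbrakk> \<Longrightarrow> x j \<noteq> 3" and n4: "\<And>j. \<lbrakk>p' < j; j < q'\<rbrakk> \<Longrightarrow> x j \<noteq> 4"
    using that[of "u + L" "v + L"] by (auto simp: inner_gap_def eval_nat_numeral)
  have nz: "x i \<noteq> 0" for i using x_zero T by fastforce
  have nb3: "x i = 2 \<or> x i = 4" if "nb T 3 (x i)" for i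
    using that T nz[of i] by (auto simp: nb_def type_matrix_def Let_def min_def max_def split: if_splits)
  have nb2: "x i = 1 \<or> x i = 3" if "nb T 2 (x i)" for i
    using that T nz[of i] by (auto simp: nb_def type_matrix_def Let_def min_def max_def split: if_splits)
  have nb1: "x i = 2" if "nb T 1 (x i)" for i
    using that T nz[of i] by (auto simp: nb_def type_matrix_def Let_def min_def max_def split: if_splits)
  have labels: "type_matrix T 1 2 = 5" "type_matrix T 2 3 = 3" "type_matrix T 3 2 = 3" "type_matrix T 3 4 = 3"
    using T by (auto simp: type_matrix_def path_label_def Let_def)
  have s1: "separates 2 1" using nb1 by (rule separates_leaf)
  have s3: "separates 2 3" using separates_right[of 2] N T by simp
  \<comment> \<open>The two neighbours of 3 in the gap are 2s with no 3 between them. Consecutive 2s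
    are chosen from there; the 3s at \<open>p'\<close> and \<open>q'\<close> lie outside and matter
    for \<open>k < i + L\<close>.\<close>
  obtain a b where ab: "p' < a" "a < b" "b < q'" "nb T 3 (x a)" "nb T 3 (x b)"
    using two_neighbours[OF g'(2-)] nb3 labels by metis
  have "x a = 2" "x b = 2" using nb3[OF ab(4)] nb3[OF ab(5)] n4[of a] n4[of b] ab by auto
  then obtain c where c: "a < c" "c \<le> b" "x c = 2" and n2: "\<And>i. \<lbrakk>a < i; i < c\<rbrakk> \<Longrightarrow> x i \<noteq> 2"
    using next_occurrence[OF ab(2)] by metis
  obtain p q where p: "p = a" and q: "q = c" by blast
  have pq: "p < q" "q < p + L" "x p = 2" "x q = 2" "L \<le> p"
    and p'q': "p' < p" "q < q'" and n2: "\<And>i. \<lbrakk>p < i; i < q\<rbrakk> \<Longrightarrow> x i \<noteq> 2"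
    using c n2 \<open>x a = 2\<close> ab g' by (auto simp: p q)
  obtain l r where g: "l < p" "q \<le> l + L" "x l = 2" "\<And>i. \<lbrakk>l < i; i < p\<rbrakk> \<Longrightarrow> x i \<noteq> 2"
    "q < r" "r \<le> p + L" "x r = 2" "\<And>i. \<lbrakk>q < i; i < r\<rbrakk> \<Longrightarrow> x i \<noteq> 2"
    by (rule adjacent_gaps[OF pq(5,1-4)]) (rule that)
  have le: "q \<le> p + L" "r \<le> q + L" "r < q + L" "p \<le> l + L" "p < l + L" using pq g by auto
  have one: "\<exists>w. a < w \<and> w < b \<and> x w = 1"
    if ab: "a < b" "b < a + L" "x a = 2" "x b = 2" and n: "\<And>w. \<lbrakk>a < w; w < b\<rbrakk> \<Longrightarrow> x w \<noteq> 2" for a b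
  proof (rule ccontr)
    assume no: "\<not> ?thesis"
    obtain w where w: "a < w" "w < b" "nb T 2 (x w)" using no_square[OF ab] by blast
    have x3: "x w = 3" using nb2[OF w(3)] no w by blast
    obtain w' where w': "a < w'" "w' < b" "w' \<noteq> w" "nb T 2 (x w')"
      using no_braid3[OF w(1,2) ab(2-)] x3 labels by auto
    have x3': "x w' = 3" using nb2[OF w'(4)] no w' by blast
    have "b \<le> a + L" using ab by simp
    from separates_unique[OF s3 n this w(1,2) x3 w'(1,2) x3'] w' show False by simp
  qed
  obtain j where j: "p < j" "j < q" "x j = 1" using one[OF pq(1-4) n2] by blast
  obtain k where k: "q < k" "k < r" "x k = 1" using one[OF g(5) le(3) pq(4) g(7,8)] by blast
  obtain i where i: "l < i" "i < p" "x i = 1" using one[OF g(1) le(5) g(3) pq(3) g(4)] by blast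
  note unique_i = separates_unique[OF s1 g(4) le(4) _ _ _ i]
    and unique_j = separates_unique[OF s1 n2 le(1) _ _ _ j]
    and unique_k = separates_unique[OF s1 g(8) le(2) _ _ _ k]
  \<comment> \<open>The braid \<open>1 2 1 2 1\<close> has to fit into one period. Were
    \<open>k = i + L\<close>, the only 2s of a period would be those at \<open>p\<close> and
    \<open>q\<close>, and the 3s at \<open>q'\<close> and \<open>p' + L\<close> would both lie in
    the gap from \<open>q\<close> to \<open>r\<close>.\<close>
  have "k < i + L"
  proof (rule ccontr)
    assume "\<not> k < i + L"
    moreover have "\<not> i + L < k"
      using unique_k[of "i + L"] periodic i k g by auto
    ultimately have ki: "k = i + L" by simp
    have "\<not> q < l + L" using g(8)[of "l + L"] periodic g(3) ki i k by auto
    then have "q = l + L" using g by simp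
    then have "l < r - L" "x (r - L) = 2" using g periodic[of "r - L"] by auto
    then have "r = p + L" using g(4)[of "r - L"] g(6) by linarith
    then show False
      using separates_unique[OF s3 g(8) le(2), of q' "p' + L"] p'q' g' periodic by auto
  qed
  have c2: "type_matrix T 2 (x w) = 2" if "p < w" "w < q" "w \<noteq> j" for w
    using that unique_j[of w] nb2[of w] n2[of w] n3[of w] p'q' by (auto simp: nb_def)
  have c1: "type_matrix T 1 (x w) = 2" if w: "i < w" "w < j" "w \<noteq> p" for w
  proof -
    have "x w \<noteq> 2" using n2[of w] g(4)[of w] i j w by (cases "w < p") auto
    moreover have "x w \<noteq> 1" using unique_i[of w] unique_j[of w] i j w by (cases "w < p") auto
    ultimately show ?thesis using nb1[of w] by (auto simp: nb_def)
  qed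
  have c1': "type_matrix T 1 (x w) = 2" if w: "j < w" "w < k" "w \<noteq> q" for w
  proof -
    have "x w \<noteq> 2" using n2[of w] g(8)[of w] k j w by (cases "w < q") auto
    moreover have "x w \<noteq> 1" using unique_k[of w] unique_j[of w] k j w by (cases "w < q") auto
    ultimately show ?thesis using nb1[of w] by (auto simp: nb_def)
  qed
  from no_braid5[OF i(2) j(1,2) k(1) \<open>k < i + L\<close> i(3) pq(3) j(3) pq(4) k(3) labels(1) c1 c2 c1']
  show False by blast
qed

lemma no_inner_gap_penultimate: "\<not> inner_gap (N - 1) p q"
proof
  assume g: "inner_gap (N - 1) p q"
  \<comment> \<open>The descent ends at the branch vertex, except that type H stops at 3, which
    \<open>4 \<le> N\<close> makes reachable from \<open>N - 1\<close>.\<close>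
  let ?b = "if T = Type_H then 3 else branch_vertex T"
  have "\<exists>u v. inner_gap ?b u v"
    by (rule inner_gap_descend[OF _ _ g]) (use N in auto)
  then show False
    using no_inner_gap_A no_inner_gap_B no_inner_gap_D no_inner_gap_E no_inner_gap_F no_inner_gap_H
    by (cases T) auto
qed

theorem last_two_once:
  assumes "p < q" "q < p + L" "x p = x q"
  shows "x p \<noteq> N \<and> x p \<noteq> N - 1"
  using inner_gap_of_last[OF assms(1,2)] inner_gap_of_penultimate[OF assms(1,2)] assms(3)
    no_inner_gap_penultimate by metis

end

section \<open>The cyclic word of a CFC element\<close>

lemma branch_vertex_pos: "0 < branch_vertex T"
  by (cases T) auto

lemma count_list_le_1:
  assumes "\<And>p q. \<lbrakk>p < q; q < length u; u ! p = a; u ! q = a\<rbrakk> \<Longrightarrow> False"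
  shows "count_list u a \<le> 1"
proof -
  have "count_list u a = card {i. i < length u \<and> a = u ! i}"
    by (simp add: count_list_eq_length_filter length_filter_conv_card)
  moreover have "card {i. i < length u \<and> a = u ! i} \<le> Suc 0"
    using assms by (subst card_le_Suc0_iff_eq) (auto, metis nat_neq_iff)
  ultimately show ?thesis by simp
qed

context coxeter_group
begin

context
  fixes y :: "nat \<Rightarrow> 'a" and L :: nat
  assumes fc: "\<And>P. fc_word (map y [P..<P + L])"
begin

lemma window_in_S:
  assumes "0 < L"
  shows "y i \<in> S"
  using reduced_lists[OF fc_word_reduced[OF fc[of i]]] assms by auto

lemma map_upt_split: "\<lbrakk>a \<le> i; i < b\<rbrakk> \<Longrightarrow> map y [a..<b] = map y [a..<i] @ [y i] @ map y [Suc i..<b]"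
  by (metis append_Cons append_Nil less_imp_le_nat list.simps(9) map_append upt_conv_Cons upt_add_eq_append
      le_add_diff_inverse)

lemma window_no_square:
  assumes pq: "p < q" "q < p + L" "y p = a" "y q = a"
  shows "\<exists>i. p < i \<and> i < q \<and> a \<noteq> y i \<and> m a (y i) \<noteq> 2"
proof (rule ccontr)
  assume n: "\<not> ?thesis"
  \<comment> \<open>With the first recurrence of \<open>a\<close>, all letters in between differ
    from \<open>a\<close>, so by assumption they commute with it.\<close>
  define r where "r = (LEAST i. p < i \<and> y i = a)"
  have r: "p < r" "y r = a"
    using LeastI[of "\<lambda>i. p < i \<and> y i = a" q] pq by (simp_all add: r_def)
  have rq: "r \<le> q" using Least_le[of "\<lambda>i. p < i \<and> y i = a" q] pq by (simp add: r_def)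
  have S: "y i \<in> S" for i using window_in_S pq by simp
  have "m c a = 2" if c: "c \<in> set (map y [Suc p..<r])" for c
  proof -
    obtain i where i: "c = y i" "p < i" "i < r" using c by auto
    have "y i \<noteq> a" using not_less_Least[of i "\<lambda>i. p < i \<and> y i = a"] i by (auto simp: r_def)
    then have "m a (y i) = 2" using n i rq by (metis less_le_trans)
    then show ?thesis using i S m_two_sym pq(3) by metis
  qed
  moreover have "map y [p..<p + L] = [] @ [a] @ map y [Suc p..<r] @ [a] @ map y [Suc r..<p + L]"
    using map_upt_split[of p p "p + L"] map_upt_split[of "Suc p" r "p + L"] pq r rq by simp
  ultimately show False
    using reduced_no_square fc_word_reduced[OF fc[of p]] by metis
qed

lemma window_no_braid3:
  assumes pq: "p < j" "j < q" "q < p + L" "y p = a" "y q = a" and m3: "m a (y j) = 3"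
  shows "\<exists>i. p < i \<and> i < q \<and> i \<noteq> j \<and> a \<noteq> y i \<and> m a (y i) \<noteq> 2"
proof (rule ccontr)
  assume n: "\<not> ?thesis"
  have S: "y i \<in> S" for i using window_in_S pq by simp
  \<comment> \<open>A further \<open>a\<close> would, by \<open>window_no_square\<close> on the side
    of it away from \<open>j\<close>, yield a second neighbour.\<close>
  have "y i \<noteq> a" if i: "p < i" "i < q" "i \<noteq> j" for i
  proof
    assume yi: "y i = a"
    show False
    proof (cases "i < j")
      case True
      then obtain w where "p < w" "w < i" "a \<noteq> y w" "m a (y w) \<noteq> 2"
        using window_no_square[of p i a] pq i yi by auto
      then show False using n True pq by (metis less_trans less_irrefl)
    next
      case False
      then obtain w where "i < w" "w < q" "a \<noteq> y w" "m a (y w) \<noteq> 2"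
        using window_no_square[of i q a] pq i yi by auto
      then show False using n False pq i by (metis less_trans)
    qed
  qed
  then have "m a (y i) = 2" if "p < i" "i < q" "i \<noteq> j" for i
    using that n by metis
  then have c: "m (y i) a = 2" if "p < i" "i < q" "i \<noteq> j" for i
    using that m_two_sym[OF S S, of i p] pq(4) by simp
  have "map y [p..<p + L] =
      [] @ [a] @ map y [Suc p..<j] @ [y j] @ map y [Suc j..<q] @ [a] @ map y [Suc q..<p + L]"
    using map_upt_split[of p p "p + L"] map_upt_split[of "Suc p" j "p + L"]
      map_upt_split[of "Suc j" q "p + L"] pq by simp
  moreover have "\<forall>c\<in>set (map y [Suc p..<j]). m c a = 2" "\<forall>c\<in>set (map y [Suc j..<q]). m c a = 2"
    using c pq by auto
  ultimately show False using fc_word_no_braid3 fc[of p] m3 by metis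
qed

lemma window_no_braid4:
  assumes p: "p0 < p1" "p1 < p2" "p2 < p3" "p3 < p0 + L"
    and y: "y p0 = a" "y p1 = b" "y p2 = a" "y p3 = b" and m4: "m a b = 4"
    and a: "\<And>i. \<lbrakk>p0 < i; i < p2; i \<noteq> p1\<rbrakk> \<Longrightarrow> m a (y i) = 2"
    and b: "\<And>i. \<lbrakk>p1 < i; i < p3; i \<noteq> p2\<rbrakk> \<Longrightarrow> m b (y i) = 2"
  shows False
proof -
  have S: "y i \<in> S" for i using window_in_S p by simp
  have a': "m (y i) a = 2" if "p0 < i" "i < p2" "i \<noteq> p1" for i using a[OF that] S y m_two_sym by metis
  have b': "m (y i) b = 2" if "p1 < i" "i < p3" "i \<noteq> p2" for i using b[OF that] S y m_two_sym by metis
  have "map y [p0..<p0 + L] = [] @ [a] @ map y [Suc p0..<p1] @ [b] @ map y [Suc p1..<p2] @ [a] @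
      map y [Suc p2..<p3] @ [b] @ map y [Suc p3..<p0 + L]"
    using map_upt_split[of p0 p0 "p0 + L"] map_upt_split[of "Suc p0" p1 "p0 + L"]
      map_upt_split[of "Suc p1" p2 "p0 + L"] map_upt_split[of "Suc p2" p3 "p0 + L"] p y by simp
  then have "fc_word ([] @ [a] @ map y [Suc p0..<p1] @ [b] @ map y [Suc p1..<p2] @ [a] @
      map y [Suc p2..<p3] @ [b] @ map y [Suc p3..<p0 + L])"
    using fc[of p0] by metis
  from fc_word_no_braid4[OF this m4] show False using a' b' p by auto
qed

lemma window_no_braid5:
  assumes p: "p0 < p1" "p1 < p2" "p2 < p3" "p3 < p4" "p4 < p0 + L"
    and y: "y p0 = a" "y p1 = b" "y p2 = a" "y p3 = b" "y p4 = a" and m5: "m a b = 5"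
    and a: "\<And>i. \<lbrakk>p0 < i; i < p2; i \<noteq> p1\<rbrakk> \<Longrightarrow> m a (y i) = 2"
    and b: "\<And>i. \<lbrakk>p1 < i; i < p3; i \<noteq> p2\<rbrakk> \<Longrightarrow> m b (y i) = 2"
    and c: "\<And>i. \<lbrakk>p2 < i; i < p4; i \<noteq> p3\<rbrakk> \<Longrightarrow> m a (y i) = 2"
  shows False
proof -
  have S: "y i \<in> S" for i using window_in_S p by simp
  have a': "m (y i) a = 2" if "p0 < i" "i < p2" "i \<noteq> p1" for i using a[OF that] S y m_two_sym by metis
  have b': "m (y i) b = 2" if "p1 < i" "i < p3" "i \<noteq> p2" for i using b[OF that] S y m_two_sym by metis
  have c': "m (y i) a = 2" if "p2 < i" "i < p4" "i \<noteq> p3" for i using c[OF that] S y m_two_sym by metis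
  have "map y [p0..<p0 + L] = [] @ [a] @ map y [Suc p0..<p1] @ [b] @ map y [Suc p1..<p2] @ [a] @
      map y [Suc p2..<p3] @ [b] @ map y [Suc p3..<p4] @ [a] @ map y [Suc p4..<p0 + L]"
    using map_upt_split[of p0 p0 "p0 + L"] map_upt_split[of "Suc p0" p1 "p0 + L"]
      map_upt_split[of "Suc p1" p2 "p0 + L"] map_upt_split[of "Suc p2" p3 "p0 + L"]
      map_upt_split[of "Suc p3" p4 "p0 + L"] p y by simp
  then have "fc_word ([] @ [a] @ map y [Suc p0..<p1] @ [b] @ map y [Suc p1..<p2] @ [a] @
      map y [Suc p2..<p3] @ [b] @ map y [Suc p3..<p4] @ [a] @ map y [Suc p4..<p0 + L])"
    using fc[of p0] by metis
  from fc_word_no_braid5[OF this m5] show False using a' b' c' p by auto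
qed

end

lemma map_nth_mod_eq_rotate: "map (\<lambda>i. u ! (i mod length u)) [P..<P + length u] = rotate P u"
  by (rule nth_equalityI) (simp_all add: nth_rotate)

lemma last_two_generators_once:
  assumes lab: "coxeter_labelling T n \<nu> S m"
    and size: "N = path_length T n" "branch_vertex T < N" "T = Type_H \<longrightarrow> 4 \<le> N"
    and u: "reduced u" "ev u \<in> CFC W S m"
  shows "count_list u (\<nu> N) \<le> 1 \<and> count_list u (\<nu> (N - 1)) \<le> 1"
proof -
  let ?L = "length u"
  have bij: "bij_betw \<nu> (vertices T n) S"
    and lm: "\<And>i j. \<lbrakk>i \<in> vertices T n; j \<in> vertices T n\<rbrakk> \<Longrightarrow> m (\<nu> i) (\<nu> j) = type_matrix T i j"
    using lab by (auto simp: coxeter_labelling_def)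
  have False if pq: "p < q" "q < ?L" "u ! p = \<nu> k" "u ! q = \<nu> k" and k: "k = N \<or> k = N - 1" for p q k
  proof -
    \<comment> \<open>The word is repeated periodically; each window of full length is one of its
      rotations and hence an FC word.\<close>
    define y where "y i = u ! (i mod ?L)" for i
    define x where "x i = inv_into (vertices T n) \<nu> (y i)" for i
    have fc: "fc_word (map y [P..<P + ?L])" for P
      using map_nth_mod_eq_rotate[of u P] u CFC_iff unfolding y_def by metis
    have "0 < ?L" using pq by (cases u) auto
    then have yS: "y i \<in> S" for i by (rule window_in_S[OF fc])
    have xv: "x i \<in> vertices T n" for i
      unfolding x_def using yS bij by (metis bij_betw_def inv_into_into)
    have yx: "y i = \<nu> (x i)" for i
      unfolding x_def using yS bij by (metis bij_betw_def f_inv_into_f)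
    have inj: "\<nu> a = \<nu> b \<longleftrightarrow> a = b" if "a \<in> vertices T n" "b \<in> vertices T n" for a b
      using bij that by (auto simp: bij_betw_def inj_on_def)
    have my: "m (y i) (y j) = type_matrix T (x i) (x j)" for i j
      unfolding yx using lm xv by simp
    have eqy: "y i = y j \<longleftrightarrow> x i = x j" for i j
      unfolding yx using inj xv by simp
    interpret cyclic_fc T N x ?L
    proof
      show "branch_vertex T < N" "T = Type_H \<longrightarrow> 4 \<le> N" using size by auto
      show "x i \<le> N" for i using xv[of i] size(1) by (cases T) (auto simp: vertices_def)
      show "T = Type_D \<or> T = Type_E" if "x i = 0" for i
        using xv[of i] that by (cases T) (auto simp: vertices_def)
      show "x (i + ?L) = x i" for i by (simp add: x_def y_def)
      show "\<exists>i. p < i \<and> i < q \<and> nb T a (x i)"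
        if "p < q" "q < p + ?L" "x p = a" "x q = a" for p q a
        using window_no_square[OF fc that(1,2), of "y p"] that eqy my by (auto simp: nb_def)
      show "\<exists>i. p < i \<and> i < q \<and> i \<noteq> j \<and> nb T a (x i)"
        if "p < j" "j < q" "q < p + ?L" "x p = a" "x q = a" "type_matrix T a (x j) = 3" for p q j a
        using window_no_braid3[OF fc that(1-3), of "y p"] that eqy my by (auto simp: nb_def)
      show False
        if "p0 < p1" "p1 < p2" "p2 < p3" "p3 < p0 + ?L"
          "x p0 = a" "x p1 = b" "x p2 = a" "x p3 = b" "type_matrix T a b = 4"
          "\<And>i. \<lbrakk>p0 < i; i < p2; i \<noteq> p1\<rbrakk> \<Longrightarrow> type_matrix T a (x i) = 2"
          "\<And>i. \<lbrakk>p1 < i; i < p3; i \<noteq> p2\<rbrakk> \<Longrightarrow> type_matrix T b (x i) = 2" for p0 p1 p2 p3 a b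
        using window_no_braid4[OF fc that(1-4), of "y p0" "y p1"] that eqy my by auto
      show False
        if "p0 < p1" "p1 < p2" "p2 < p3" "p3 < p4" "p4 < p0 + ?L"
          "x p0 = a" "x p1 = b" "x p2 = a" "x p3 = b" "x p4 = a" "type_matrix T a b = 5"
          "\<And>i. \<lbrakk>p0 < i; i < p2; i \<noteq> p1\<rbrakk> \<Longrightarrow> type_matrix T a (x i) = 2"
          "\<And>i. \<lbrakk>p1 < i; i < p3; i \<noteq> p2\<rbrakk> \<Longrightarrow> type_matrix T b (x i) = 2"
          "\<And>i. \<lbrakk>p2 < i; i < p4; i \<noteq> p3\<rbrakk> \<Longrightarrow> type_matrix T a (x i) = 2" for p0 p1 p2 p3 p4 a b
        using window_no_braid5[OF fc that(1-5), of "y p0" "y p1"] that eqy my by auto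
    qed
    have "y p = \<nu> k" "y q = \<nu> k" using pq by (simp_all add: y_def)
    moreover have "k \<in> vertices T n"
      using k size(2) branch_vertex_pos[of T] by (auto simp: vertices_def size(1)[symmetric])
    ultimately have "x p = k" "x q = k" using yx inj xv by metis+
    then show False using last_two_once[of p q] pq k by auto
  qed
  then show ?thesis using count_list_le_1 by metis
qed

end

theorem corollary5p7:
  fixes W :: "('a, 'b) monoid_scheme" and S J K :: "'a set"
    and m :: "'a \<Rightarrow> 'a \<Rightarrow> enat" and \<nu> :: "nat \<Rightarrow> 'a" and T :: cfc_type and n :: nat
  assumes "n \<ge> 4"
    and "T = Type_E \<longrightarrow> n \<ge> 6"
    and "coxeter_system W S m"
    and "card S = n"
    and "coxeter_irreducible S m"
    and "CFC_finite W S m"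
    and "coxeter_labelling T n \<nu> S m"
    and "J = S - {\<nu> (rightmost T n)}"
    and "K = J - {\<nu> (rightmost T (n - 1))}"
  shows "int (card (CFC W S m)) =
           3 * int (card (CFC (subgroup_generated W J) J m))
           - int (card (CFC (subgroup_generated W K) K m))"
proof -
  define N where "N = path_length T n"
  \<comment> \<open>The extra vertex makes \<open>N = n - 1\<close> in types D and E, where still
    \<open>N \<ge> 3\<close> and \<open>N \<ge> 5\<close>, so the last edge belongs to the branch
    and has label 3.\<close>
  have N: "branch_vertex T < N" "T = Type_H \<longrightarrow> 4 \<le> N"
    and path: "path_length T (n - 1) = N - 1"
    using assms(1,2) by (cases T; simp add: N_def)+
  have rightmost: "rightmost T n = N" "rightmost T (n - 1) = N - 1"
    using N path by (auto simp: rightmost_def branch_def N_def intro!: Max_eqI)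
  have v: "N \<in> vertices T n" "N - 1 \<in> vertices T n"
    using N(1) branch_vertex_pos[of T] by (auto simp: vertices_def N_def[symmetric])
  have lm: "\<And>i j. \<lbrakk>i \<in> vertices T n; j \<in> vertices T n\<rbrakk> \<Longrightarrow> m (\<nu> i) (\<nu> j) = type_matrix T i j"
    and bij: "bij_betw \<nu> (vertices T n) S"
    using assms(7) by (auto simp: coxeter_labelling_def)
  have "group W" using assms(3) by (simp add: coxeter_system_def)
  then interpret coxeter_group W S m
    by (intro coxeter_group.intro coxeter_group_axioms.intro assms(3))
  interpret coxeter_leaf W S m "\<nu> (N - 1)" "\<nu> N"
  proof
    show "\<nu> (N - 1) \<in> S" "\<nu> N \<in> S" using v bij by (auto simp: bij_betw_def)
    show "m (\<nu> (N - 1)) (\<nu> N) = 3"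
      using lm[OF v(2,1)] type_matrix_path[of T "N - 1"] N by simp
    show "m r (\<nu> N) = 2" if r: "r \<in> S" "r \<noteq> \<nu> (N - 1)" "r \<noteq> \<nu> N" for r
    proof -
      obtain c where c: "c \<in> vertices T n" "r = \<nu> c" using r bij by (auto simp: bij_betw_def)
      then have "c \<noteq> N" "c \<noteq> N - 1" using r by auto
      moreover have "c \<le> N" using c by (cases T) (auto simp: vertices_def N_def)
      ultimately have "\<not> nb T N c" using nb_path[OF N(1), of c] by auto
      then have "type_matrix T N c = 2" using \<open>c \<noteq> N\<close> by (simp add: nb_def)
      then show ?thesis using lm[OF c(1) v(1)] c(2) type_matrix_sym by metis
    qed
  qed
  have JK: "J = S - {\<nu> N}" "K = S - {\<nu> N} - {\<nu> (N - 1)}"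
    using assms(8,9) rightmost by auto
  have once: "count_list u (\<nu> (N - 1)) \<le> 1 \<and> count_list u (\<nu> N) \<le> 1"
    if "reduced u" "ev u \<in> CFC W S m" for u
    using last_two_generators_once[OF assms(7) N_def N that] by simp
  have "finite (CFC W S m)" using assms(6) by (simp add: CFC_finite_def)
  from card_CFC[OF once this] show ?thesis
    unfolding JK CFC_parabolic[OF J_subset] CFC_parabolic[OF K_subset] .
qed

end
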